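(* Let $q=2^m$ with $m\ge 2$ and let $S\subset(\mathbb{Z}/q\mathbb{Z})^\times$. Then the limit $\lim_{x\to\infty}P_S(x)$ exists in $(0,\infty)$ if and only if $\mu(S)=0$.
   Context: Throughout, $p$ denotes an odd prime. The function $\chi_4$ is given on odd integers by $\chi_4(n)=1$ if $n\equiv 1\pmod 4$ and $\chi_4(n)=-1$ if $n\equiv 3\pmod 4$. For an odd prime $p$ set $A(p)=\dfrac{p-\chi_4(p)}{p+\chi_4(p)}$. Here $(\mathbb{Z}/q\mathbb{Z})^\times$ is the group of reduced residue classes modulo $q$. Since $4\mid q$, each $a\in(\mathbb{Z}/q\mathbb{Z})^\times$ has a well-defined value $\chi_4(a)\in\{\pm1\}$. For $S\subset(\mathbb{Z}/q\mathbb{Z})^\times$ define $$P_S(x)=\prod_{\substack{p\le x\\ p\bmod q\in S}}A(p),\qquad \mu(S)=\sum_{a\in S}\chi_4(a).$$ *)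

theory Defs
  imports "HOL-Analysis.Analysis" "HOL-Number_Theory.Residues"
begin

text \<open>
  The value 0 at even integers is a convention; only odd arguments matter below.
\<close>
definition chi4 :: "int \<Rightarrow> int" where
  "chi4 n = (if n mod 4 = 1 then 1 else if n mod 4 = 3 then -1 else 0)"

text \<open>
  When 4 divides \<open>q\<close>, the value of \<open>chi4\<close> depends only on the residue class modulo \<open>q\<close>,
  so it may be evaluated at the representatives that form the carrier of \<open>residue_ring q\<close>.
\<close>
lemma chi4_mod:
  assumes "4 dvd q"
  shows "chi4 (n mod q) = chi4 n"
  using assms by (simp add: chi4_def mod_mod_cancel)

definition A :: "nat \<Rightarrow> real" where
  "A p = (real p - of_int (chi4 (int p))) / (real p + of_int (chi4 (int p)))"

definition P :: "int \<Rightarrow> int set \<Rightarrow> real \<Rightarrow> real" where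
  "P q S x = (\<Prod>p | prime p \<and> odd p \<and> real p \<le> x \<and> int p mod q \<in> S. A p)"

lemma finite_P_index: "finite {p. prime p \<and> odd p \<and> real p \<le> x \<and> int p mod q \<in> S}"
  by (rule finite_subset[of _ "{..nat \<lfloor>x\<rfloor>}"]) (auto simp: le_nat_floor)

definition mu :: "int set \<Rightarrow> int" where
  "mu S = (\<Sum>a\<in>S. chi4 a)"

end

theory Submission
  imports Defs "HOL-Number_Theory.Number_Theory" "HOL-Computational_Algebra.Squarefree"
begin

text \<open>
Write \<open>c\<close> for \<open>chi4\<close>. Since \<open>ln (A p) = ln (1 - c p / p) - ln (1 + c p / p) = - 2 * c p / p + O (1 / p\<^sup>2)\<close>,
the product \<open>P q S\<close> has a positive limit iff the series \<open>\<Sum> c p / p\<close> over the odd primes \<open>p\<close> with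
\<open>p mod q \<in> S\<close> converges (\<open>P_converges_iff\<close>, \<open>log_term_summable_iff\<close>). Here \<open>p \<mapsto> c p\<close>, restricted to
these primes, is a function of \<open>p mod q\<close>, so it is a linear combination of the Dirichlet characters modulo
\<open>2 ^ m\<close>, in which the principal character has the coefficient \<open>mu S / 2 ^ (m - 1)\<close>. The series
\<open>\<Sum> \<chi> p / p\<close> converges for every nonprincipal \<open>\<chi>\<close>, and \<open>\<Sum> 1 / p\<close> diverges; hence the series converges
iff \<open>mu S = 0\<close> (\<open>prime_sum_over_residues_summable_iff\<close>).

Both facts about the primes come from the von Mangoldt function \<open>\<Lambda>\<close> and the identity
\<open>ln n = \<Sum>d | d dvd n. \<Lambda> d\<close>, without complex analysis. Summed over \<open>n\<close>, it gives Chebyshev's bound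
\<open>psi n = O (n)\<close> and Mertens' estimate \<open>\<Sum>n\<le>N. \<Lambda> n / n = ln N + O (1)\<close>. Twisted by a nonprincipal \<open>\<chi>\<close>, it gives
\<open>L(1, \<chi>) * (\<Sum>n\<le>N. \<chi> n * \<Lambda> n / n) = O (1)\<close>, where \<open>L(1, \<chi>) = \<Sum> \<chi> n / n\<close>
(\<open>nonprincipal_character.Lambda_sum_bounded\<close>). If \<open>L(1, \<chi>) \<noteq> 0\<close>, then partial summation against \<open>1 / ln n\<close>
gives the convergence of \<open>\<Sum> \<chi> p / p\<close>, as the higher prime powers contribute an absolutely convergent series.

It remains to see that \<open>L(1, \<chi>) \<noteq> 0\<close>. If \<open>L(1, \<chi>) = 0\<close>, then Moebius inversion shows that
\<open>\<Sum>n\<le>N. \<chi> n * \<Lambda> n / n = - ln N + O (1)\<close>. When \<open>\<chi>\<^sup>2\<close> is nonprincipal too, this contradicts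
\<open>3 + 4 * Re z + Re (z\<^sup>2) \<ge> 0\<close> for \<open>norm z \<le> 1\<close>, because the weighted sum would be at most \<open>(3 - 4) * ln N + O (1)\<close>
(\<open>L_value_nonzero_if_square_nonprincipal\<close>). A nonprincipal \<open>\<chi>\<close> modulo \<open>2 ^ m\<close> with principal square is one of
the three real characters modulo 8, and for these the series \<open>L(1, \<chi>)\<close>, summed in blocks of eight terms, is visibly
positive (\<open>twopow_char_L_value_nonzero\<close>).
\<close>

section \<open>Partial summation\<close>

text \<open>
Abel summation: with \<open>S n = \<Sum>k\<in>{M<..n}. a k\<close>, the sum is \<open>S N * g (N + 1)\<close> plus a combination of the \<open>S n\<close> with the
nonnegative weights \<open>g n - g (n + 1)\<close>, and all weights together telescope to \<open>g (M + 1)\<close>.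
\<close>
lemma norm_sum_mult_antimono_le:
  fixes a :: "nat \<Rightarrow> complex" and g :: "nat \<Rightarrow> real"
  assumes bound: "\<And>n. norm (\<Sum>k\<in>{M<..n}. a k) \<le> B"
    and dec: "\<And>n. n > M \<Longrightarrow> g (Suc n) \<le> g n"
    and nonneg: "\<And>n. n > M \<Longrightarrow> 0 \<le> g n"
  shows "norm (\<Sum>n\<in>{M<..N}. a n * g n) \<le> B * g (Suc M)"
proof (cases "M \<le> N")
  case True
  define S where "S n = (\<Sum>k\<in>{M<..n}. a k)" for n
  have S_Suc: "S (Suc n) = S n + a (Suc n)" if "n \<ge> M" for n
  proof -
    have "{M<..Suc n} = insert (Suc n) {M<..n}" using that by auto
    then show ?thesis by (simp add: S_def)
  qed
  have *: "(\<Sum>n\<in>{M<..N}. a n * g n) = S N * g (Suc N) + (\<Sum>n\<in>{M<..N}. S n * (g n - g (Suc n)))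
      \<and> (\<Sum>n\<in>{M<..N}. g n - g (Suc n)) = g (Suc M) - g (Suc N)"
    using True
  proof (induction N rule: dec_induct)
    case base
    show ?case by (simp add: S_def)
  next
    case (step n)
    have "{M<..Suc n} = insert (Suc n) {M<..n}" using step(1) by auto
    then show ?case using step S_Suc[of n] by (simp add: algebra_simps)
  qed
  have "B \<ge> 0" using order_trans[OF norm_ge_zero bound] .
  have "norm (\<Sum>n\<in>{M<..N}. a n * g n) \<le> norm (S N * g (Suc N)) + norm (\<Sum>n\<in>{M<..N}. S n * (g n - g (Suc n)))"
    unfolding conjunct1[OF *] by (rule norm_triangle_ineq)
  also have "norm (S N * g (Suc N)) \<le> B * g (Suc N)"
    using bound[of N] nonneg[of "Suc N"] True
    by (auto simp: norm_mult S_def intro!: mult_right_mono)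
  also have "norm (\<Sum>n\<in>{M<..N}. S n * (g n - g (Suc n))) \<le> (\<Sum>n\<in>{M<..N}. B * (g n - g (Suc n)))"
  proof (rule sum_norm_le)
    fix n assume "n \<in> {M<..N}"
    then show "norm (S n * (g n - g (Suc n))) \<le> B * (g n - g (Suc n))"
      using bound[of n] dec[of n] \<open>B \<ge> 0\<close> unfolding norm_mult S_def
      by (intro mult_mono) (auto simp flip: of_real_diff)
  qed
  also have "\<dots> = B * (g (Suc M) - g (Suc N))"
    using * by (simp flip: sum_distrib_left)
  finally show ?thesis by (simp add: algebra_simps)
next
  case False
  have "B \<ge> 0" using order_trans[OF norm_ge_zero bound] .
  then show ?thesis using False nonneg[of "Suc M"] by simp
qed

text \<open>
Dirichlet's test. The rate of convergence is part of the conclusion because the estimates for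
\<open>\<Sum>k\<le>N div d. \<chi> k / k\<close> are later summed over \<open>d\<close>.
\<close>
lemma dirichlet_test:
  fixes a :: "nat \<Rightarrow> complex" and g :: "nat \<Rightarrow> real"
  assumes bound: "\<And>n. norm (\<Sum>k\<in>{1..n}. a k) \<le> B"
    and dec: "\<And>n. n \<ge> K \<Longrightarrow> g (Suc n) \<le> g n"
    and lim: "g \<longlonglongrightarrow> 0"
  obtains L where "(\<lambda>N. \<Sum>n\<in>{1..N}. a n * g n) \<longlonglongrightarrow> L"
    and "\<And>N. N \<ge> K \<Longrightarrow> norm ((\<Sum>n\<in>{1..N}. a n * g n) - L) \<le> 2 * B * g (Suc N)"
proof -
  define T where "T N = (\<Sum>n\<in>{1..N}. a n * g n)" for N
  have split: "(\<Sum>n\<in>{1..N}. h n) = (\<Sum>n\<in>{1..M}. h n) + (\<Sum>n\<in>{M<..N}. h n)" if "M \<le> N"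
    for h :: "nat \<Rightarrow> complex" and M N
  proof -
    have "{1..N} = {1..M} \<union> {M<..N}" using that by auto
    then show ?thesis by (simp only:) (rule sum.union_disjoint; auto)
  qed
  have bound': "norm (\<Sum>k\<in>{M<..n}. a k) \<le> 2 * B" for M n
  proof (cases "M \<le> n")
    case True
    show ?thesis using split[where h = a, OF True] bound[of n] bound[of M]
      norm_triangle_ineq4[of "\<Sum>k\<in>{1..n}. a k" "\<Sum>k\<in>{1..M}. a k"] by simp
  next
    case False
    then show ?thesis using order_trans[OF norm_ge_zero bound] by simp
  qed
  have nonneg: "0 \<le> g n" if "n \<ge> K" for n
  proof -
    have "g m \<le> g n" if "m \<ge> n" for m
      using that by (induction m rule: dec_induct) (use \<open>n \<ge> K\<close> dec in \<open>auto intro: order_trans\<close>)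
    then have "eventually (\<lambda>m. g m \<le> g n) sequentially"
      by (auto simp: eventually_sequentially)
    then show ?thesis using lim tendsto_upperbound by force
  qed
  have diff: "norm (T N - T M) \<le> 2 * B * g (Suc M)" if "K \<le> M" "M \<le> N" for M N
    unfolding T_def split[OF that(2)]
    using norm_sum_mult_antimono_le[where M = M and a = a and B = "2*B" and g = g and N = N] bound' dec nonneg that by simp
  have lim2: "(\<lambda>M. 2 * B * g (Suc M)) \<longlonglongrightarrow> 0"
    using tendsto_mult[OF tendsto_const[of "2*B"] LIMSEQ_Suc[OF lim]] by simp
  have "Cauchy T"
  proof (rule CauchyI')
    fix e :: real assume "e > 0"
    have "eventually (\<lambda>M. 2 * B * g (Suc M) < e) sequentially"
      using order_tendstoD(2)[OF lim2 \<open>e > 0\<close>] .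
    then obtain M0 where M0: "\<And>M. M \<ge> M0 \<Longrightarrow> 2 * B * g (Suc M) < e"
      by (auto simp: eventually_sequentially)
    have "norm (T m - T n) < e" if "m \<ge> max K M0" "n > m" for m n
      using diff[of m n] M0[of m] that by (auto simp: norm_minus_commute)
    then show "\<exists>M. \<forall>m\<ge>M. \<forall>n>m. dist (T m) (T n) < e"
      by (intro exI[of _ "max K M0"]) (auto simp: dist_norm)
  qed
  then obtain L where L: "T \<longlonglongrightarrow> L" using Cauchy_convergent_iff convergent_def by blast
  have tail: "norm (T N - L) \<le> 2 * B * g (Suc N)" if "N \<ge> K" for N
  proof -
    have "(\<lambda>n. norm (T n - T N)) \<longlonglongrightarrow> norm (L - T N)"
      using L by (intro tendsto_intros)
    moreover have "eventually (\<lambda>n. norm (T n - T N) \<le> 2 * B * g (Suc N)) sequentially"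
      using diff[OF that] by (auto simp: eventually_sequentially)
    ultimately have "norm (L - T N) \<le> 2 * B * g (Suc N)"
      using tendsto_upperbound by force
    then show ?thesis by (simp add: norm_minus_commute)
  qed
  show thesis using that[OF L[unfolded T_def] tail[unfolded T_def]] .
qed

lemma sums_if_partial_sums_from_1:
  fixes f :: "nat \<Rightarrow> 'a :: real_normed_vector"
  assumes "(\<lambda>N. \<Sum>n\<in>{1..N}. f n) \<longlonglongrightarrow> l" and "f 0 = 0"
  shows "f sums l"
proof -
  have "(\<Sum>n\<in>{..N}. f n) = (\<Sum>n\<in>{1..N}. f n)" for N
    by (rule sum.mono_neutral_right) (use assms(2) not_less_eq_eq in auto)
  then show ?thesis using assms(1) by (simp add: sums_def_le)
qed

text \<open>
The threshold is the least integer above \<open>exp 1\<close>, where the derivative of \<open>ln x / x\<close> changes its sign.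
\<close>
lemma ln_div_self_decreasing:
  assumes "n \<ge> 3"
  shows "ln (real (Suc n)) / real (Suc n) \<le> ln (real n) / real n"
proof -
  have "exp 1 \<le> real n" using exp_le assms by linarith
  then have "1 \<le> ln (real n)" using assms by (subst ln_ge_iff) auto
  have "real n * ln (real (Suc n) / real n) \<le> real n * (real (Suc n) / real n - 1)"
    by (intro mult_left_mono ln_le_minus_one) (use assms in auto)
  also have "\<dots> = 1" using assms by (simp add: field_simps)
  also have "ln (real (Suc n) / real n) = ln (real (Suc n)) - ln (real n)"
    using assms by (subst ln_div) auto
  finally have "real n * ln (real (Suc n)) \<le> real (Suc n) * ln (real n)"
    using \<open>1 \<le> ln (real n)\<close> by (simp add: algebra_simps)
  then show ?thesis using assms by (simp add: divide_simps mult.commute del: of_nat_Suc)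
qed

lemma not_ln_bounded: "\<not> (\<forall>N\<ge>1. ln (real N) \<le> C)"
proof
  assume *: "\<forall>N\<ge>1. ln (real N) \<le> C"
  obtain N where N: "real N > exp C" using reals_Archimedean2 by blast
  then have "N \<ge> 1" using exp_gt_zero[of C] by (cases N) (auto simp: not_less)
  moreover have "ln (real N) > C" using N \<open>N \<ge> 1\<close> by (metis exp_gt_zero ln_exp ln_less_cancel_iff order.strict_trans)
  ultimately show False using * by auto
qed

section \<open>The estimates of Chebyshev and Mertens\<close>

text \<open>
Both sides run over the pairs \<open>(d, k)\<close> with \<open>d * k \<le> N\<close>; this is how information on divisor sums turns into
information on sums over \<open>d \<le> N\<close>.
\<close>
lemma sum_divisors_swap:
  fixes F :: "nat \<Rightarrow> nat \<Rightarrow> 'a :: comm_monoid_add"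
  shows "(\<Sum>n\<in>{1..N}. \<Sum>d | d dvd n. F d (n div d)) = (\<Sum>d\<in>{1..N}. \<Sum>k\<in>{1..N div d}. F d k)"
proof -
  have "(\<Sum>n\<in>{1..N}. \<Sum>d | d dvd n. F d (n div d)) = (\<Sum>(n,d)\<in>(SIGMA n:{1..N}. {d. d dvd n}). F d (n div d))"
    by (rule sum.Sigma) auto
  also have "\<dots> = (\<Sum>(d,k)\<in>(SIGMA d:{1..N}. {1..N div d}). F d k)"
  proof (rule sum.reindex_bij_witness[where i = "\<lambda>(d,k). (d*k,d)" and j = "\<lambda>(n,d). (d, n div d)"], goal_cases)
    case (2 z)
    obtain n d where z: "z = (n, d)" by (cases z)
    then have "1 \<le> n" "n \<le> N" "d dvd n" using 2 by auto
    then have "d > 0" "d \<le> n" by (auto intro: dvd_imp_le Nat.gr0I)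
    with \<open>n \<le> N\<close> \<open>d dvd n\<close> \<open>1 \<le> n\<close> show ?case
      by (auto simp: z div_le_mono intro: Suc_leI div_greater_zero_iff[THEN iffD2])
  next
    case (4 z)
    obtain d k where z: "z = (d, k)" by (cases z)
    then have "1 \<le> d" "1 \<le> k" "k \<le> N div d" using 4 by auto
    then have "d * k \<le> N" by (metis less_eq_div_iff_mult_less_eq mult.commute One_nat_def Suc_le_eq)
    then show ?case using \<open>1 \<le> d\<close> \<open>1 \<le> k\<close> by (auto simp: z)
  qed auto
  also have "\<dots> = (\<Sum>d\<in>{1..N}. \<Sum>k\<in>{1..N div d}. F d k)"
    by (rule sum.Sigma[symmetric]) auto
  finally show ?thesis .
qed

lemma sum_ln_eq_sum_mangoldt:
  "(\<Sum>n\<in>{1..N}. ln (real n)) = (\<Sum>d\<in>{1..N}. mangoldt d * real (N div d))"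
proof -
  have "(\<Sum>n\<in>{1..N}. ln (real n)) = (\<Sum>n\<in>{1..N}. \<Sum>d | d dvd n. mangoldt d)"
    by (intro sum.cong refl) (use mangoldt_sum[where ?'a = real] in auto)
  also have "\<dots> = (\<Sum>d\<in>{1..N}. \<Sum>k\<in>{1..N div d}. mangoldt d)"
    by (rule sum_divisors_swap)
  finally show ?thesis by (simp add: mult.commute)
qed

lemma sum_ln_eq_ln_fact: "(\<Sum>n\<in>{1..N}. ln (real n)) = ln (fact N)"
proof (induction N)
  case (Suc N)
  have "ln (fact (Suc N) :: real) = ln (real (Suc N)) + ln (fact N)"
    unfolding fact_Suc by (subst ln_mult) auto
  with Suc show ?case by simp
qed simp

lemma sum_ln_le: "(\<Sum>n\<in>{1..N}. ln (real n)) \<le> real N * ln (real N)"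
proof -
  have "(\<Sum>n\<in>{1..N}. ln (real n)) \<le> (\<Sum>n\<in>{1..N}. ln (real N))"
    by (rule sum_mono) auto
  then show ?thesis by simp
qed

lemma sum_ln_ge: "(\<Sum>n\<in>{1..N}. ln (real n)) \<ge> real N * ln (real N) - real N"
proof (induction N)
  case (Suc N)
  show ?case
  proof (cases "N = 0")
    case False
    have "real N * ln (real (Suc N) / real N) \<le> real N * (real (Suc N) / real N - 1)"
      by (intro mult_left_mono ln_le_minus_one) (use False in auto)
    also have "\<dots> = 1" using False by (simp add: field_simps)
    also have "ln (real (Suc N) / real N) = ln (real (Suc N)) - ln (real N)"
      using False by (subst ln_div) auto
    finally show ?thesis using Suc by (simp add: algebra_simps)
  qed simp
qed simp

text \<open>
Chebyshev's function, often written \<open>\<psi>\<close>.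
\<close>
definition psi :: "nat \<Rightarrow> real" where
  "psi N = (\<Sum>n\<in>{1..N}. mangoldt n)"

text \<open>
\<open>ln (2 n choose n) = \<Sum>d. \<Lambda> d * (2 n div d - 2 * (n div d))\<close> has only nonnegative terms, and those with
\<open>n < d \<le> 2 n\<close> are \<open>\<Lambda> d\<close>; on the other hand, the binomial coefficient is at most \<open>4 ^ n\<close>.
\<close>
lemma psi_double: "psi (2 * n) \<le> psi n + real n * ln 4"
proof -
  have split: "(\<Sum>d\<in>{1..2*n}. h d) = (\<Sum>d\<in>{1..n}. h d) + (\<Sum>d\<in>{n<..2*n}. h d)" for h :: "nat \<Rightarrow> real"
  proof -
    have "{1..2*n} = {1..n} \<union> {n<..2*n}" by auto
    then show ?thesis by (simp only:) (rule sum.union_disjoint; auto)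
  qed
  have mono: "mangoldt d * real (2 * n div d) \<ge> 2 * (mangoldt d * real (n div d))" for d
  proof -
    have "2 * (n div d) \<le> 2 * n div d"
      by (cases "d = 0") (auto simp: less_eq_div_iff_mult_less_eq)
    then have "2 * real (n div d) \<le> real (2 * n div d)" by linarith
    then have "mangoldt d * (2 * real (n div d)) \<le> mangoldt d * real (2 * n div d)"
      by (intro mult_left_mono) (auto simp: mangoldt_nonneg)
    then show ?thesis by (simp add: algebra_simps)
  qed
  have "psi (2*n) - psi n = (\<Sum>d\<in>{n<..2*n}. mangoldt d)"
    unfolding psi_def split by simp
  also have "\<dots> \<le> (\<Sum>d\<in>{n<..2*n}. mangoldt d * real (2 * n div d))"
  proof (rule sum_mono)
    fix d assume d: "d \<in> {n<..2*n}"
    then have "2 * n div d \<ge> 1" by (auto intro!: Suc_leI div_greater_zero_iff[THEN iffD2])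
    then have "mangoldt d * 1 \<le> mangoldt d * real (2 * n div d)"
      by (intro mult_left_mono) (auto simp: mangoldt_nonneg)
    then show "mangoldt d \<le> mangoldt d * real (2 * n div d)" by simp
  qed
  also have "\<dots> \<le> (\<Sum>d\<in>{1..2*n}. mangoldt d * real (2 * n div d)) - 2 * (\<Sum>d\<in>{1..n}. mangoldt d * real (n div d))"
    unfolding split sum_distrib_left using sum_mono[of "{1..n}", OF mono] by simp
  also have "\<dots> = ln (fact (2*n)) - 2 * ln (fact n)"
    by (simp only: sum_ln_eq_sum_mangoldt[symmetric] sum_ln_eq_ln_fact)
  also have "\<dots> = ln (real ((2*n) choose n))"
  proof -
    have "fact n * fact (2*n - n) * ((2*n) choose n) = (fact (2*n) :: nat)"
      by (rule binomial_fact_lemma) simp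
    then have "fact n * fact n * real ((2*n) choose n) = fact (2*n)"
      by (simp del: fact_Suc) (metis of_nat_fact of_nat_mult)
    moreover have "ln (fact n * fact n * real ((2*n) choose n)) = 2 * ln (fact n) + ln (real ((2*n) choose n))"
      by (simp add: ln_mult)
    ultimately show ?thesis by simp
  qed
  also have "\<dots> \<le> ln (4 ^ n)"
  proof (subst ln_le_cancel_iff)
    show "real ((2 * n) choose n) \<le> 4 ^ n"
    proof -
      have "(2*n) choose n \<le> 2 ^ (2*n)" by (rule binomial_le_pow2)
      then have "real ((2 * n) choose n) \<le> real (2 ^ (2*n))" by (rule of_nat_mono)
      then show ?thesis by (simp add: power_mult)
    qed
  qed auto
  also have "\<dots> = real n * ln 4" by (simp add: ln_realpow)
  finally show ?thesis by simp
qed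

text \<open>
Halving with rounding up, \<open>k = (n + 1) div 2\<close>, keeps \<open>n \<le> 2 k\<close>, so that no term for odd \<open>n\<close> has to be
treated apart. The rounding is absorbed by \<open>n - 1\<close> in place of \<open>n\<close>: the induction step needs
\<open>4 k \<le> 3 n\<close>, which fails only at \<open>n = 1\<close>.
\<close>
lemma psi_le:
  assumes "n \<ge> 1"
  shows "psi n \<le> 3 * ln 4 * (real n - 1)"
  using assms
proof (induction n rule: less_induct)
  case (less n)
  show ?case
  proof (cases "n = 1")
    case True
    then show ?thesis by (simp add: psi_def)
  next
    case False
    define k where "k = (n + 1) div 2"
    have k: "k < n" "k \<ge> 1" "n \<le> 2 * k" "2 * k \<le> n + 1" using False less.prems by (auto simp: k_def)
    have "psi n \<le> psi (2 * k)"
      unfolding psi_def using k by (intro sum_mono2) (auto simp: mangoldt_nonneg)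
    also have "\<dots> \<le> psi k + real k * ln 4" by (rule psi_double)
    also have "psi k \<le> 3 * ln 4 * (real k - 1)" using less.IH k by simp
    also have "3 * ln 4 * (real k - 1) + real k * ln 4 = ln 4 * (4 * real k - 3)"
      by (simp add: algebra_simps)
    also have "\<dots> \<le> ln 4 * (3 * real n - 3)"
    proof (rule mult_left_mono)
      have "4 * k \<le> 3 * n" using k False less.prems by linarith
      then show "4 * real k - 3 \<le> 3 * real n - 3" by linarith
    qed simp
    finally show ?thesis by (simp add: algebra_simps)
  qed
qed

lemma psi_bound:
  obtains c where "c > 0" "\<And>n. psi n \<le> c * real n"
proof
  show "(3 * ln 4 :: real) > 0" by simp
  show "psi n \<le> 3 * ln 4 * real n" for n
  proof (cases "n = 0")
    case False
    then have "psi n \<le> 3 * ln 4 * (real n - 1)" by (intro psi_le) simp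
    also have "\<dots> \<le> 3 * ln 4 * real n" by (intro mult_left_mono) auto
    finally show ?thesis .
  qed (simp add: psi_def)
qed

lemma nat_div_bounds:
  assumes "d > 0"
  shows "real (N div d) \<le> real N / real d" "real N / real d \<le> real (N div d) + 1"
proof -
  show "real (N div d) \<le> real N / real d" by (rule of_nat_div_le_of_nat)
  have "N < d * (N div d + 1)" using assms by (simp add: dividend_less_times_div)
  then have "real N < real (d * (N div d + 1))" by (rule of_nat_less_iff[THEN iffD2])
  then show "real N / real d \<le> real (N div d) + 1" using assms by (simp add: field_simps)
qed

text \<open>
Compare \<open>N / d\<close> with \<open>N div d\<close> in \<open>\<Sum>n\<le>N. ln n = \<Sum>d\<le>N. \<Lambda> d * (N div d)\<close>; the error is at most \<open>psi N = O (N)\<close>.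
\<close>
lemma mertens_upper:
  obtains C where "\<And>N. N \<ge> 1 \<Longrightarrow> (\<Sum>n\<in>{1..N}. mangoldt n / real n) \<le> ln (real N) + C"
proof -
  obtain c where c: "c > 0" "\<And>n. psi n \<le> c * real n" using psi_bound by blast
  have "(\<Sum>n\<in>{1..N}. mangoldt n / real n) \<le> ln (real N) + c" if "N \<ge> 1" for N
  proof -
    have "real N * (\<Sum>n\<in>{1..N}. mangoldt n / real n) = (\<Sum>n\<in>{1..N}. mangoldt n * (real N / real n))"
      unfolding sum_distrib_left by (rule sum.cong) simp_all
    also have "\<dots> \<le> (\<Sum>n\<in>{1..N}. mangoldt n * (real (N div n) + 1))"
      by (intro sum_mono mult_left_mono nat_div_bounds) (auto simp: mangoldt_nonneg)
    also have "\<dots> = (\<Sum>n\<in>{1..N}. ln (real n)) + psi N"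
      unfolding sum_ln_eq_sum_mangoldt psi_def by (simp add: sum.distrib distrib_left)
    also have "\<dots> \<le> real N * ln (real N) + c * real N"
      by (intro add_mono sum_ln_le c)
    also have "\<dots> = real N * (ln (real N) + c)" by (simp add: algebra_simps)
    finally show ?thesis using that by (simp add: mult_le_cancel_left)
  qed
  then show thesis using that by blast
qed

lemma mertens_lower:
  assumes "N \<ge> 1"
  shows "(\<Sum>n\<in>{1..N}. mangoldt n / real n) \<ge> ln (real N) - 1"
proof -
  have "real N * (ln (real N) - 1) \<le> (\<Sum>n\<in>{1..N}. ln (real n))"
    using sum_ln_ge[of N] by (simp add: algebra_simps)
  also have "\<dots> = (\<Sum>n\<in>{1..N}. mangoldt n * real (N div n))" by (rule sum_ln_eq_sum_mangoldt)
  also have "\<dots> \<le> (\<Sum>n\<in>{1..N}. mangoldt n * (real N / real n))"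
    by (intro sum_mono mult_left_mono nat_div_bounds) (auto simp: mangoldt_nonneg)
  also have "\<dots> = real N * (\<Sum>n\<in>{1..N}. mangoldt n / real n)"
    unfolding sum_distrib_left by (rule sum.cong) simp_all
  finally show ?thesis using assms by (simp add: mult_le_cancel_left)
qed

section \<open>Moebius inversion\<close>

definition moebius_mu :: "nat \<Rightarrow> real" where
  "moebius_mu n = (if squarefree n then (-1) ^ card (prime_factors n) else 0)"

lemma abs_moebius_le: "\<bar>moebius_mu n\<bar> \<le> 1"
  by (simp add: moebius_mu_def)

lemma moebius_prime_mult:
  assumes "prime p" "\<not> p dvd d" "d > 0"
  shows "moebius_mu (p * d) = - moebius_mu d"
proof -
  have cop: "coprime p d" using assms prime_imp_coprime by blast
  have "squarefree (p * d) \<longleftrightarrow> squarefree d"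
    using squarefree_mult_coprime[OF cop] squarefree_prime[OF assms(1)] squarefree_multD(2) by blast
  moreover have "prime_factors (p * d) = insert p (prime_factors d)"
    using assms by (subst prime_factors_product) (auto simp: prime_prime_factors)
  moreover have "p \<notin> prime_factors d" using assms by auto
  ultimately show ?thesis by (simp add: moebius_mu_def)
qed

text \<open>
For a fixed prime \<open>p\<close> dividing \<open>n\<close>, the map \<open>d \<mapsto> p * d\<close> pairs the squarefree divisors not divisible by \<open>p\<close> with
those divisible by \<open>p\<close>, and it changes the sign of the Moebius function.
\<close>
lemma sum_moebius:
  assumes "n > 0"
  shows "(\<Sum>d | d dvd n. moebius_mu d) = (if n = 1 then 1 else 0)"
proof (cases "n = 1")
  case True
  then show ?thesis by (simp add: moebius_mu_def)
next
  case False
  then obtain p where p: "prime p" "p dvd n" using prime_factor_nat by blast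
  define D where "D = {d. d dvd n \<and> squarefree d}"
  define D0 where "D0 = {d\<in>D. \<not> p dvd d}"
  have fin: "finite {d. d dvd n}" using assms by simp
  have finD0: "finite D0" using fin by (rule rev_finite_subset) (auto simp: D0_def D_def)
  have pos: "d > 0" if "d \<in> D" for d using that assms by (auto simp: D_def intro: Nat.gr0I)
  have D: "D = D0 \<union> (*) p ` D0"
  proof (intro subset_antisym subsetI)
    fix d assume d: "d \<in> D"
    show "d \<in> D0 \<union> (*) p ` D0"
    proof (cases "p dvd d")
      case True
      then obtain e where e: "d = p * e" by blast
      have "\<not> p dvd e"
      proof
        assume "p dvd e"
        then have "p ^ 2 dvd d" using e by (simp add: power2_eq_square)
        then show False using d p by (auto simp: D_def squarefree_def)
      qed
      moreover have "e \<in> D" using d e squarefree_multD(2)[of p e] dvd_mult_right[of p e n] by (simp add: D_def)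
      ultimately show ?thesis using e by (auto simp: D0_def)
    qed (use d in \<open>auto simp: D0_def\<close>)
  next
    fix d assume "d \<in> D0 \<union> (*) p ` D0"
    then show "d \<in> D"
    proof
      assume "d \<in> (*) p ` D0"
      then obtain e where e: "d = p * e" "e \<in> D" "\<not> p dvd e" by (auto simp: D0_def)
      have "coprime p e" using p e prime_imp_coprime by blast
      then have "squarefree d" "d dvd n"
        using e p squarefree_mult_coprime squarefree_prime by (auto simp: D_def intro: divides_mult)
      then show ?thesis by (auto simp: D_def)
    qed (auto simp: D0_def)
  qed
  have "(\<Sum>d | d dvd n. moebius_mu d) = (\<Sum>d\<in>D. moebius_mu d)"
    by (rule sum.mono_neutral_right) (use fin in \<open>auto simp: D_def moebius_mu_def\<close>)
  also have "\<dots> = (\<Sum>d\<in>D0. moebius_mu d) + (\<Sum>d\<in>(*) p ` D0. moebius_mu d)"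
    unfolding D using finD0 by (intro sum.union_disjoint) (auto simp: D0_def)
  also have "(\<Sum>d\<in>(*) p ` D0. moebius_mu d) = (\<Sum>d\<in>D0. moebius_mu (p * d))"
    using p by (subst sum.reindex) (auto simp: inj_on_def prime_gt_0_nat)
  also have "\<dots> = (\<Sum>d\<in>D0. - moebius_mu d)"
    using p pos by (intro sum.cong refl moebius_prime_mult) (auto simp: D0_def)
  finally show ?thesis using False by (simp add: sum_negf)
qed

lemma sum_divisors_commute:
  fixes F :: "nat \<Rightarrow> nat \<Rightarrow> 'a :: comm_monoid_add"
  assumes "n > 0"
  shows "(\<Sum>d | d dvd n. \<Sum>e | e dvd n div d. F d e) = (\<Sum>e | e dvd n. \<Sum>d | d dvd n div e. F d e)"
proof -
  have fin: "finite {d. d dvd n}" "\<And>d. d dvd n \<Longrightarrow> finite {e. e dvd n div d}"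
    using assms by auto
  have *: "d dvd n \<and> e dvd n div d \<longleftrightarrow> d * e dvd n" for d e
  proof
    assume *: "d dvd n \<and> e dvd n div d"
    then have "d * e dvd d * (n div d)" by (intro mult_dvd_mono) auto
    then show "d * e dvd n" using * by simp
  next
    assume *: "d * e dvd n"
    then show "d dvd n \<and> e dvd n div d" using assms
      by (metis dvd_mult_imp_div mult.commute dvd_mult_left)
  qed
  have "(\<Sum>d | d dvd n. \<Sum>e | e dvd n div d. F d e)
      = (\<Sum>(d,e)\<in>(SIGMA d:{d. d dvd n}. {e. e dvd n div d}). F d e)"
    using fin by (intro sum.Sigma) auto
  also have "(SIGMA d:{d. d dvd n}. {e. e dvd n div d}) = {(d,e). d * e dvd n}"
    using * by auto
  also have "(\<Sum>(d,e)\<in>{(d,e). d * e dvd n}. F d e) = (\<Sum>(e,d)\<in>{(e,d). e * d dvd n}. F d e)"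
    by (rule sum.reindex_bij_witness[where i = prod.swap and j = prod.swap]) (auto simp: mult.commute)
  also have "{(e,d). e * d dvd n} = (SIGMA e:{e. e dvd n}. {d. d dvd n div e})"
    using * by auto
  also have "(\<Sum>(e,d)\<in>(SIGMA e:{e. e dvd n}. {d. d dvd n div e}). F d e)
      = (\<Sum>e | e dvd n. \<Sum>d | d dvd n div e. F d e)"
    using fin by (intro sum.Sigma[symmetric]) auto
  finally show ?thesis .
qed

text \<open>
Moebius inversion of \<open>ln n = \<Sum>d | d dvd n. \<Lambda> d\<close>.
\<close>
lemma sum_moebius_ln:
  assumes "n > 0"
  shows "(\<Sum>d | d dvd n. moebius_mu d * ln (real (n div d))) = mangoldt n"
proof -
  have "(\<Sum>d | d dvd n. moebius_mu d * ln (real (n div d))) = (\<Sum>d | d dvd n. \<Sum>e | e dvd n div d. moebius_mu d * mangoldt e)"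
  proof (intro sum.cong refl)
    fix d assume "d \<in> {d. d dvd n}"
    then have "n div d \<noteq> 0" using assms by (auto simp: dvd_div_eq_0_iff)
    then show "moebius_mu d * ln (real (n div d)) = (\<Sum>e | e dvd n div d. moebius_mu d * mangoldt e)"
      using mangoldt_sum[of "n div d", where ?'a = real] by (simp flip: sum_distrib_left)
  qed
  also have "\<dots> = (\<Sum>e | e dvd n. \<Sum>d | d dvd n div e. moebius_mu d * mangoldt e)"
    by (rule sum_divisors_commute[OF assms])
  also have "\<dots> = (\<Sum>e | e dvd n. if e = n then mangoldt e else 0)"
  proof (intro sum.cong refl)
    fix e assume "e \<in> {e. e dvd n}"
    then have "n div e > 0" "n div e = 1 \<longleftrightarrow> e = n" using assms by (auto elim!: dvdE)
    then show "(\<Sum>d | d dvd n div e. moebius_mu d * mangoldt e) = (if e = n then mangoldt e else 0)"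
      using sum_moebius[of "n div e"] by (simp flip: sum_distrib_right)
  qed
  also have "\<dots> = mangoldt n" using assms by (simp add: sum.delta)
  finally show ?thesis .
qed

text \<open>
The term at \<open>n = 1\<close> is what makes \<open>- ln N\<close> appear in the case \<open>L(1, \<chi>) = 0\<close>: there, \<open>x\<close> is the length \<open>N\<close> of the sum
over \<open>n\<close>, and the factors \<open>ln (N / d)\<close> are small where the estimate of the inner sum is poor.
\<close>
lemma sum_moebius_ln_shifted:
  assumes "n > 0" "x > 0"
  shows "(\<Sum>d | d dvd n. moebius_mu d * ln (x / real d)) = mangoldt n + (if n = 1 then ln x else 0)"
proof -
  have "(\<Sum>d | d dvd n. moebius_mu d * ln (x / real d))
      = (\<Sum>d | d dvd n. moebius_mu d * ln (real (n div d)) + moebius_mu d * (ln x - ln (real n)))"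
  proof (intro sum.cong refl)
    fix d assume d: "d \<in> {d. d dvd n}"
    then have "d > 0" using assms by (auto intro: Nat.gr0I)
    then have "ln (x / real d) = ln (real (n div d)) + (ln x - ln (real n))"
      using assms d by (simp add: real_of_nat_div ln_div)
    then show "moebius_mu d * ln (x / real d) = moebius_mu d * ln (real (n div d)) + moebius_mu d * (ln x - ln (real n))"
      by (simp only: distrib_left)
  qed
  also have "\<dots> = mangoldt n + (\<Sum>d | d dvd n. moebius_mu d) * (ln x - ln (real n))"
    by (simp add: sum.distrib sum_moebius_ln[OF assms(1)] sum_distrib_right)
  finally show ?thesis using sum_moebius[OF assms(1)] by auto
qed

section \<open>Character sums weighted by the von Mangoldt function\<close>

text \<open>
The properties of a nonprincipal Dirichlet character modulo \<open>q\<close> that the analysis uses. Vanishing of the sum over a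
period is the form in which nonprincipality enters: it bounds all partial sums.
\<close>
locale nonprincipal_character =
  fixes chi :: "nat \<Rightarrow> complex" and q :: nat
  assumes q_pos: "q > 0"
    and one: "chi 1 = 1"
    and mult: "chi (a * b) = chi a * chi b"
    and norm_le: "norm (chi n) \<le> 1"
    and periodic: "chi (n + q) = chi n"
    and sum_zero: "(\<Sum>n<q. chi n) = 0"
begin

text \<open>
The partial sums of the Dirichlet series of \<open>chi\<close> at 1, whose limit \<open>L_value\<close> is the value \<open>L(1, \<chi>)\<close>.
\<close>
definition L_partial :: "nat \<Rightarrow> complex" where
  "L_partial N = (\<Sum>n\<in>{1..N}. chi n * of_real (1 / real n))"

definition L_value :: complex where
  "L_value = lim L_partial"

definition Lambda_sum :: "nat \<Rightarrow> complex" where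
  "Lambda_sum N = (\<Sum>n\<in>{1..N}. chi n * of_real (mangoldt n / real n))"

definition period_bound :: real where
  "period_bound = real q + 1"

lemma period_bound_pos: "period_bound > 0" by (simp add: period_bound_def)

lemma norm_period_sum_le: "norm (\<Sum>k\<in>{1..n}. chi k) \<le> period_bound"
proof -
  have *: "norm (\<Sum>k<n. chi k) \<le> q" for n
  proof (induction n rule: less_induct)
    case (less n)
    show ?case
    proof (cases "n < q")
      case True
      have "norm (\<Sum>k<n. chi k) \<le> (\<Sum>k<n. 1)" by (intro sum_norm_le norm_le)
      then show ?thesis using True by simp
    next
      case False
      have "(\<Sum>k<n. chi k) = (\<Sum>k<q. chi k) + (\<Sum>k\<in>{q..<n}. chi k)"
        using sum.atLeastLessThan_concat[of 0 q n chi] False by (simp add: lessThan_atLeast0)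
      also have "(\<Sum>k\<in>{q..<n}. chi k) = (\<Sum>k<n-q. chi (k + q))"
        by (rule sum.reindex_bij_witness[where i = "\<lambda>k. k + q" and j = "\<lambda>k. k - q"]) auto
      finally have "(\<Sum>k<n. chi k) = (\<Sum>k<n-q. chi k)" by (simp only: sum_zero periodic add_0)
      then show ?thesis using less.IH[of "n - q"] q_pos False by simp
    qed
  qed
  have "(\<Sum>k\<in>{1..n}. chi k) = (\<Sum>k<Suc n. chi k) - chi 0"
  proof -
    have "{..<Suc n} = insert 0 {1..n}" by auto
    then show ?thesis by simp
  qed
  then have "norm (\<Sum>k\<in>{1..n}. chi k) \<le> norm (\<Sum>k<Suc n. chi k) + norm (chi 0)"
    using norm_triangle_ineq4 by metis
  also have "\<dots> \<le> period_bound" unfolding period_bound_def by (intro add_mono * norm_le)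
  finally show ?thesis .
qed

lemma L_partial_convergence:
  shows L_partial_tendsto: "L_partial \<longlonglongrightarrow> L_value" and L_partial_tail: "N \<ge> 1 \<Longrightarrow> norm (L_partial N - L_value) \<le> 2 * period_bound * (1 / real (Suc N))"
proof -
  obtain l where l: "L_partial \<longlonglongrightarrow> l" and tail: "\<And>N. N \<ge> 1 \<Longrightarrow> norm (L_partial N - l) \<le> 2 * period_bound * (1 / real (Suc N))"
    using dirichlet_test[where a = chi and g = "\<lambda>n. 1 / real n" and K = 1 and B = period_bound,
        OF norm_period_sum_le _ lim_1_over_n, folded L_partial_def]
    by (auto simp: field_simps)
  have "l = L_value" using l by (simp add: L_value_def limI)
  then show "L_partial \<longlonglongrightarrow> L_value" and "N \<ge> 1 \<Longrightarrow> norm (L_partial N - L_value) \<le> 2 * period_bound * (1 / real (Suc N))"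
    using l tail by auto
qed

text \<open>
The bound is linear in \<open>d\<close>, so it cancels the denominator of the weights \<open>u d / d\<close> in \<open>sum_convolution\<close>.
\<close>
lemma L_partial_div_tail:
  assumes "d \<in> {1..N}"
  shows "norm (L_partial (N div d) - L_value) \<le> 2 * period_bound * (real d / real N)"
proof -
  have "norm (L_partial (N div d) - L_value) \<le> 2 * period_bound * (1 / real (Suc (N div d)))"
    using assms by (intro L_partial_tail) (auto intro!: Suc_leI div_greater_zero_iff[THEN iffD2])
  also have "1 / real (Suc (N div d)) \<le> 1 / (real N / real d)"
    using nat_div_bounds(2)[of d N] assms by (intro divide_left_mono mult_pos_pos) auto
  finally show ?thesis using period_bound_pos by (simp add: mult_left_mono)
qed

lemma sum_ln_bounded: "\<exists>C. \<forall>N. norm (\<Sum>n\<in>{1..N}. chi n * of_real (ln (real n) / real n)) \<le> C"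
proof -
  obtain l where "(\<lambda>N. \<Sum>n\<in>{1..N}. chi n * of_real (ln (real n) / real n)) \<longlonglongrightarrow> l"
    using dirichlet_test[where a = chi and g = "\<lambda>n. ln (real n) / real n" and K = 3 and B = period_bound,
        OF norm_period_sum_le ln_div_self_decreasing lim_ln_over_n] by metis
  then have "Bseq (\<lambda>N. \<Sum>n\<in>{1..N}. chi n * of_real (ln (real n) / real n))"
    by (intro convergent_imp_Bseq convergentI)
  then show ?thesis by (auto simp: Bseq_def)
qed

text \<open>
Multiplicativity of \<open>chi\<close> turns a twisted sum of \<open>w n / n\<close>, for a divisor sum \<open>w\<close> of \<open>u\<close>, into a sum over \<open>d\<close> of \<open>u d / d\<close>
against partial sums of \<open>L(1, \<chi>)\<close> of length \<open>N div d\<close>. It is used once with \<open>u = \<Lambda>\<close> and once with \<open>u\<close> a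
Moebius-weighted logarithm.
\<close>
lemma sum_convolution:
  fixes u w :: "nat \<Rightarrow> real"
  assumes "\<And>n. n \<in> {1..N} \<Longrightarrow> (\<Sum>d | d dvd n. u d) = w n"
  shows "(\<Sum>n\<in>{1..N}. chi n * of_real (w n / real n))
       = (\<Sum>d\<in>{1..N}. chi d * of_real (u d / real d) * L_partial (N div d))"
proof -
  have "(\<Sum>n\<in>{1..N}. chi n * of_real (w n / real n))
      = (\<Sum>n\<in>{1..N}. \<Sum>d | d dvd n. (chi d * of_real (u d / real d)) * (chi (n div d) * of_real (1 / real (n div d))))"
  proof (intro sum.cong refl)
    fix n assume n: "n \<in> {1..N}"
    have "chi n * of_real (w n / real n) = (\<Sum>d | d dvd n. chi n * of_real (u d / real n))"
      by (simp flip: assms[OF n] add: sum_distrib_left sum_divide_distrib)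
    also have "\<dots> = (\<Sum>d | d dvd n. (chi d * of_real (u d / real d)) * (chi (n div d) * of_real (1 / real (n div d))))"
    proof (intro sum.cong refl)
      fix d assume "d \<in> {d. d dvd n}"
      then obtain k where k: "n = d * k" by auto
      then have "d > 0" "k > 0" using n by (auto intro: Nat.gr0I)
      then show "chi n * of_real (u d / real n) = (chi d * of_real (u d / real d)) * (chi (n div d) * of_real (1 / real (n div d)))"
        by (simp add: k mult)
    qed
    finally show "chi n * of_real (w n / real n) = \<dots>" .
  qed
  also have "\<dots> = (\<Sum>d\<in>{1..N}. \<Sum>k\<in>{1..N div d}. (chi d * of_real (u d / real d)) * (chi k * of_real (1 / real k)))"
    by (rule sum_divisors_swap)
  finally show ?thesis by (simp only: L_partial_def sum_distrib_left)
qed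

text \<open>
By \<open>sum_convolution\<close> with \<open>u = \<Lambda>\<close>, the bounded sum \<open>\<Sum>n\<le>N. \<chi> n * ln n / n\<close> equals \<open>L(1, \<chi>) * Lambda_sum N\<close> up to
\<open>\<Sum>d\<le>N. \<Lambda> d / d * O (d / N) = O (psi N / N)\<close>, which is bounded by Chebyshev's estimate.
\<close>
lemma Lambda_sum_bounded:
  assumes "L_value \<noteq> 0"
  shows "\<exists>C. \<forall>N. norm (Lambda_sum N) \<le> C"
proof -
  obtain C where C: "\<And>N. norm (\<Sum>n\<in>{1..N}. chi n * of_real (ln (real n) / real n)) \<le> C"
    using sum_ln_bounded by blast
  obtain c where c: "c > 0" "\<And>n. psi n \<le> c * real n" using psi_bound by blast
  have "norm (L_value * Lambda_sum N) \<le> C + 2 * period_bound * c" for N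
  proof (cases "N = 0")
    case True
    then show ?thesis using C[of 0] period_bound_pos c by (simp add: Lambda_sum_def)
  next
    case False
    have "(\<Sum>n\<in>{1..N}. chi n * of_real (ln (real n) / real n)) = (\<Sum>d\<in>{1..N}. chi d * of_real (mangoldt d / real d) * L_partial (N div d))"
      by (rule sum_convolution) (use mangoldt_sum[where ?'a = real] in auto)
    then have "L_value * Lambda_sum N = (\<Sum>n\<in>{1..N}. chi n * of_real (ln (real n) / real n))
       - (\<Sum>d\<in>{1..N}. chi d * of_real (mangoldt d / real d) * (L_partial (N div d) - L_value))"
      by (simp only: Lambda_sum_def sum_distrib_left right_diff_distrib sum_subtractf) (simp add: mult_ac)
    then have "norm (L_value * Lambda_sum N) \<le> norm (\<Sum>n\<in>{1..N}. chi n * of_real (ln (real n) / real n))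
       + norm (\<Sum>d\<in>{1..N}. chi d * of_real (mangoldt d / real d) * (L_partial (N div d) - L_value))"
      by (simp only: norm_triangle_ineq4)
    also have "\<dots> \<le> C + (\<Sum>d\<in>{1..N}. (mangoldt d / real d) * (2 * period_bound * (real d / real N)))"
    proof (intro add_mono C sum_norm_le)
      fix d assume d: "d \<in> {1..N}"
      have "norm (chi d * of_real (mangoldt d / real d) * (L_partial (N div d) - L_value))
        = norm (chi d) * (mangoldt d / real d) * norm (L_partial (N div d) - L_value)"
        by (simp add: norm_mult mangoldt_nonneg norm_divide)
      also have "\<dots> \<le> 1 * (mangoldt d / real d) * (2 * period_bound * (real d / real N))"
        using period_bound_pos by (intro mult_mono L_partial_div_tail[OF d] norm_le mult_nonneg_nonneg) (auto simp: mangoldt_nonneg)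
      finally show "norm (chi d * of_real (mangoldt d / real d) * (L_partial (N div d) - L_value))
        \<le> (mangoldt d / real d) * (2 * period_bound * (real d / real N))" by simp
    qed
    also have "(\<Sum>d\<in>{1..N}. (mangoldt d / real d) * (2 * period_bound * (real d / real N))) = 2 * period_bound * (psi N / real N)"
      unfolding psi_def sum_divide_distrib sum_distrib_left by (intro sum.cong refl) simp
    also have "\<dots> \<le> 2 * period_bound * c"
      using c(2)[of N] period_bound_pos False by (intro mult_left_mono) (auto simp: field_simps)
    finally show ?thesis by simp
  qed
  then have "norm (Lambda_sum N) \<le> (C + 2 * period_bound * c) / norm L_value" for N
    using assms by (simp add: norm_mult field_simps)
  then show ?thesis by blast
qed

text \<open>
By \<open>sum_moebius_ln_shifted\<close>, the left-hand side is \<open>\<Sum>d\<le>N. \<mu> d * \<chi> d / d * ln (N / d)\<close> against partial sums of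
\<open>L(1, \<chi>)\<close> of length \<open>N div d\<close>. These tend to 0, so they are \<open>O (d / N)\<close>, and what is left is
\<open>\<Sum>d\<le>N. ln (N / d) / N = O (1)\<close>.
\<close>
lemma Lambda_sum_asymptotics:
  assumes "L_value = 0"
  shows "\<exists>C. \<forall>N\<ge>1. norm (Lambda_sum N + of_real (ln (real N))) \<le> C"
proof -
  have "norm (Lambda_sum N + of_real (ln (real N))) \<le> 2 * period_bound" if N: "N \<ge> 1" for N
  proof -
    have "Lambda_sum N + of_real (ln (real N)) = (\<Sum>n\<in>{1..N}. chi n * of_real ((mangoldt n + (if n = 1 then ln (real N) else 0)) / real n))"
    proof -
      have "(\<Sum>n\<in>{1..N}. chi n * of_real ((mangoldt n + (if n = 1 then ln (real N) else 0)) / real n))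
        = (\<Sum>n\<in>{1..N}. chi n * of_real (mangoldt n / real n) + (if n = 1 then of_real (ln (real N)) else 0))"
        by (intro sum.cong refl) (use one in auto)
      then show ?thesis using N by (simp add: Lambda_sum_def sum.distrib sum.delta)
    qed
    also have "\<dots> = (\<Sum>d\<in>{1..N}. chi d * of_real (moebius_mu d * ln (real N / real d) / real d) * L_partial (N div d))"
    proof (rule sum_convolution)
      fix n assume "n \<in> {1..N}"
      then show "(\<Sum>d | d dvd n. moebius_mu d * ln (real N / real d)) = mangoldt n + (if n = 1 then ln (real N) else 0)"
        by (intro sum_moebius_ln_shifted) (use N in auto)
    qed
    also have "norm \<dots> \<le> (\<Sum>d\<in>{1..N}. ln (real N / real d) / real d * (2 * period_bound * (real d / real N)))"
    proof (intro sum_norm_le)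
      fix d assume d: "d \<in> {1..N}"
      have ln: "ln (real N / real d) \<ge> 0" using d by simp
      have "norm (chi d * of_real (moebius_mu d * ln (real N / real d) / real d) * L_partial (N div d))
        = norm (chi d) * (\<bar>moebius_mu d\<bar> * (ln (real N / real d) / real d)) * norm (L_partial (N div d) - L_value)"
        using ln by (simp add: norm_mult norm_divide assms)
      also have "\<dots> \<le> 1 * (1 * (ln (real N / real d) / real d)) * (2 * period_bound * (real d / real N))"
        using ln period_bound_pos by (intro mult_mono L_partial_div_tail[OF d] norm_le abs_moebius_le mult_nonneg_nonneg) auto
      finally show "norm (chi d * of_real (moebius_mu d * ln (real N / real d) / real d) * L_partial (N div d))
        \<le> ln (real N / real d) / real d * (2 * period_bound * (real d / real N))" by simp
    qed
    also have "\<dots> = 2 * period_bound / real N * (\<Sum>d\<in>{1..N}. ln (real N) - ln (real d))"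
      unfolding sum_distrib_left by (intro sum.cong refl) (use N in \<open>auto simp: ln_div\<close>)
    also have "\<dots> = 2 * period_bound / real N * (real N * ln (real N) - (\<Sum>d\<in>{1..N}. ln (real d)))"
      by (simp add: sum_subtractf)
    also have "\<dots> \<le> 2 * period_bound / real N * real N"
      using sum_ln_ge[of N] period_bound_pos by (intro mult_left_mono) auto
    finally show ?thesis using N by simp
  qed
  then show ?thesis by blast
qed

text \<open>
Whether \<open>L(1, \<chi>)\<close> vanishes or not, an upper bound holds. This one-sided form is what \<open>\<chi>\<^sup>2\<close> needs in the
argument with \<open>3 + 4 * Re z + Re (z\<^sup>2)\<close>, where nothing is known about \<open>L(1, \<chi>\<^sup>2)\<close>.
\<close>
lemma Re_Lambda_sum_upper:
  "\<exists>C. \<forall>N\<ge>1. Re (Lambda_sum N) \<le> C"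
proof (cases "L_value = 0")
  case True
  obtain C where C: "\<And>N. N \<ge> 1 \<Longrightarrow> norm (Lambda_sum N + of_real (ln (real N))) \<le> C"
    using Lambda_sum_asymptotics[OF True] by blast
  have "Re (Lambda_sum N) \<le> C" if "N \<ge> 1" for N
  proof -
    have "0 \<le> ln (real N)" using that by simp
    moreover have "Re (Lambda_sum N) + ln (real N) \<le> C"
      using C[OF that] complex_Re_le_cmod[of "Lambda_sum N + of_real (ln (real N))"] by simp
    ultimately show ?thesis by linarith
  qed
  then show ?thesis by blast
next
  case False
  then show ?thesis using Lambda_sum_bounded complex_Re_le_cmod order_trans by meson
qed

end

section \<open>Nonvanishing for characters with nonprincipal square\<close>

text \<open>
For \<open>z = x + i y\<close> in the unit disc, \<open>3 + 4 x + x\<^sup>2 - y\<^sup>2 \<ge> 2 * (1 + x)\<^sup>2 \<ge> 0\<close>. Summing this at \<open>z = \<chi> n\<close> with the weights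
\<open>\<Lambda> n / n\<close>, a zero of \<open>L(1, \<chi>)\<close> would give \<open>0 \<le> 3 * ln N - 4 * ln N + O (1)\<close>.
\<close>
lemma L_value_nonzero_if_square_nonprincipal:
  assumes "nonprincipal_character chi q" and "nonprincipal_character (\<lambda>n. chi n ^ 2) q"
  shows "nonprincipal_character.L_value chi \<noteq> 0"
proof
  interpret X1: nonprincipal_character chi q by fact
  interpret X2: nonprincipal_character "\<lambda>n. chi n ^ 2" q by fact
  assume "X1.L_value = 0"
  then obtain C1 where C1: "\<And>N. N \<ge> 1 \<Longrightarrow> norm (X1.Lambda_sum N + of_real (ln (real N))) \<le> C1"
    using X1.Lambda_sum_asymptotics by blast
  obtain C2 where C2: "\<And>N. N \<ge> 1 \<Longrightarrow> Re (X2.Lambda_sum N) \<le> C2"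
    using X2.Re_Lambda_sum_upper by blast
  obtain C3 where C3: "\<And>N. N \<ge> 1 \<Longrightarrow> (\<Sum>n\<in>{1..N}. mangoldt n / real n) \<le> ln (real N) + C3"
    using mertens_upper by blast
  have "ln (real N) \<le> 3 * C3 + 4 * C1 + C2" if N: "N \<ge> 1" for N
  proof -
    have pos: "3 + 4 * Re z + Re (z ^ 2) \<ge> 0" if "norm z \<le> 1" for z :: complex
    proof -
      have "(Re z)\<^sup>2 + (Im z)\<^sup>2 \<le> 1" using that by (simp add: cmod_def)
      moreover have "0 \<le> 2 * (1 + Re z)\<^sup>2" by simp
      ultimately show ?thesis by (simp add: power2_eq_square algebra_simps)
    qed
    have "0 \<le> (\<Sum>n\<in>{1..N}. (3 + 4 * Re (chi n) + Re (chi n ^ 2)) * (mangoldt n / real n))"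
      by (intro sum_nonneg mult_nonneg_nonneg pos X1.norm_le) (auto simp: mangoldt_nonneg)
    also have "\<dots> = 3 * (\<Sum>n\<in>{1..N}. mangoldt n / real n) + 4 * Re (X1.Lambda_sum N) + Re (X2.Lambda_sum N)"
      unfolding X1.Lambda_sum_def X2.Lambda_sum_def
      by (simp add: sum.distrib sum_distrib_left distrib_right mult.assoc add_divide_distrib)
    also have "\<dots> \<le> 3 * (ln (real N) + C3) + 4 * (C1 - ln (real N)) + C2"
      using C1[OF N] complex_Re_le_cmod[of "X1.Lambda_sum N + of_real (ln (real N))"] C2[OF N] C3[OF N] by simp
    finally show ?thesis by simp
  qed
  then show False using not_ln_bounded by blast
qed

section \<open>From prime powers to primes\<close>

text \<open>
A prime power \<open>n = p ^ k\<close> with \<open>k \<ge> 2\<close> satisfies \<open>n \<ge> p\<^sup>2 * 2 ^ (k - 2)\<close>, so the sum is bounded by the product of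
\<open>\<Sum> 1 / p\<^sup>2\<close> and a geometric series.
\<close>
lemma higher_prime_powers_summable:
  "summable (\<lambda>n. if primepow n \<and> \<not> prime n then 1 / real n else 0)" (is "summable ?f")
proof (rule summableI_nonneg_bounded)
  define U where "U = (\<Sum>p. 1 / real p ^ 2)"
  define V where "V = (\<Sum>k. 4 * (1/2) ^ k :: real)"
  have sumP: "summable (\<lambda>p. 1 / real p ^ 2)" using inverse_power_summable[of 2, where ?'a = real] by (simp add: field_simps)
  have sumK: "summable (\<lambda>k. 4 * (1/2) ^ k :: real)" by (intro summable_mult summable_geometric) simp
  show "(\<Sum>n<N. ?f n) \<le> U * V" for N
  proof -
    define X where "X = {n. n < N \<and> primepow n \<and> \<not> prime n}"
    have fin: "finite X" by (simp add: X_def)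
    have pk: "prime (aprimedivisor n) \<and> multiplicity (aprimedivisor n) n \<ge> 2
        \<and> n = aprimedivisor n ^ multiplicity (aprimedivisor n) n" if "n \<in> X" for n
    proof -
      from that have n: "primepow n" "\<not> prime n" by (auto simp: X_def)
      then obtain p k where p: "prime p" "k > 0" "n = p ^ k" by (auto simp: primepow_def)
      with n have "k \<noteq> 1" by auto
      with p show ?thesis by (auto simp: aprimedivisor_prime_power multiplicity_prime_power)
    qed
    define M where "M = (\<lambda>n::nat. (aprimedivisor n, multiplicity (aprimedivisor n) n))"
    have inj: "inj_on M X" unfolding inj_on_def M_def using pk by (metis prod.inject)
    have "(\<Sum>n<N. ?f n) = (\<Sum>n\<in>X. 1 / real n)"
      unfolding X_def by (rule sum.mono_neutral_cong_right) auto
    also have "\<dots> \<le> (\<Sum>n\<in>X. (\<lambda>(p,k). 1 / real p ^ 2 * (4 * (1/2) ^ k)) (M n))"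
    proof (rule sum_mono)
      fix n assume n: "n \<in> X"
      define p k where "p = aprimedivisor n" and "k = multiplicity (aprimedivisor n) n"
      have p: "prime p" "k \<ge> 2" "n = p ^ k" using pk[OF n] by (auto simp: p_def k_def)
      define j where "j = k - 2"
      have k: "k = j + 2" using p by (simp add: j_def)
      have "2 ^ j \<le> p ^ j" using prime_ge_2_nat[OF p(1)] by (rule power_mono) simp
      then have "real (2 ^ j) \<le> real (p ^ j)" by (rule of_nat_mono)
      then have "2 ^ j * real p ^ 2 \<le> real p ^ j * real p ^ 2" by (intro mult_right_mono) auto
      then have "2 ^ j * real p ^ 2 \<le> real n" by (simp add: p(3) k power_add power2_eq_square mult_ac)
      then have "1 / real n \<le> 1 / (2 ^ j * real p ^ 2)"
        using prime_gt_0_nat[OF p(1)] by (intro divide_left_mono mult_pos_pos) (auto simp: p(3))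
      also have "\<dots> = 1 / real p ^ 2 * (4 * (1/2) ^ k)" by (simp add: k power_add power_divide)
      finally show "1 / real n \<le> (\<lambda>(p,k). 1 / real p ^ 2 * (4 * (1/2) ^ k)) (M n)"
        by (simp add: M_def p_def k_def)
    qed
    also have "\<dots> = (\<Sum>(p,k)\<in>M ` X. 1 / real p ^ 2 * (4 * (1/2) ^ k))"
      using inj by (simp add: sum.reindex)
    also have "\<dots> \<le> (\<Sum>(p,k)\<in>fst ` M ` X \<times> snd ` M ` X. 1 / real p ^ 2 * (4 * (1/2) ^ k))"
      by (rule sum_mono2) (use fin in \<open>auto simp: subset_fst_snd\<close>)
    also have "\<dots> = (\<Sum>p\<in>fst ` M ` X. 1 / real p ^ 2) * (\<Sum>k\<in>snd ` M ` X. 4 * (1/2) ^ k)"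
      by (simp only: sum_product sum.cartesian_product)
    also have "\<dots> \<le> U * V"
      unfolding U_def V_def using fin sumP sumK
      by (intro mult_mono sum_le_suminf suminf_nonneg sum_nonneg) auto
    finally show ?thesis .
  qed
qed auto

text \<open>
At a prime, \<open>\<Lambda> n / (n * ln n)\<close> is exactly \<open>1 / n\<close>; the difference lives on the higher prime powers, where
\<open>\<Lambda> n \<le> ln n\<close>.
\<close>
lemma mangoldt_over_ln_diff_summable:
  "summable (\<lambda>n. mangoldt n / (real n * ln (real n)) - (if prime n then 1 / real n else 0))" (is "summable ?D")
  and mangoldt_over_ln_diff_nonneg:
  "0 \<le> mangoldt n / (real n * ln (real n)) - (if prime n then 1 / real n else 0)"
proof -
  have *: "0 \<le> ?D n \<and> ?D n \<le> (if primepow n \<and> \<not> prime n then 1 / real n else 0)" for n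
  proof (cases "prime n")
    case True
    then have "ln (real n) > 0" using prime_gt_1_nat[OF True] by simp
    then show ?thesis using True by auto
  next
    case False
    show ?thesis
    proof (cases "primepow n")
      case True
      then have "n > 1" using primepow_gt_Suc_0 by auto
      then have "ln (real n) > 0" by simp
      moreover have "mangoldt n \<le> ln (real n)" using mangoldt_le \<open>n > 1\<close> by auto
      ultimately show ?thesis using False True \<open>n > 1\<close> mangoldt_nonneg[of n]
        by (auto simp: divide_simps mult_right_mono)
    qed (use False in \<open>auto simp: mangoldt_def\<close>)
  qed
  then show "0 \<le> ?D n" by blast
  show "summable ?D"
    by (rule summable_comparison_test'[OF higher_prime_powers_summable, of 0])
       (use * in \<open>auto simp: abs_of_nonneg\<close>)
qed

text \<open>
If the sum converged, so would \<open>\<Sum> \<Lambda> n / (n * ln n)\<close>. Its tail beyond some \<open>M\<close> is less than \<open>1 / 2\<close>, so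
\<open>\<Sum>n\<le>N. \<Lambda> n / n\<close> would be at most \<open>ln N / 2 + O (1)\<close>, against Mertens' lower bound \<open>ln N - 1\<close>.
\<close>
lemma prime_harmonic_not_summable: "\<not> summable (\<lambda>n. if prime n then 1 / real n else 0)"
proof
  assume "summable (\<lambda>n. if prime n then 1 / real n else 0)"
  from summable_add[OF this mangoldt_over_ln_diff_summable]
  have sm: "summable (\<lambda>n. mangoldt n / (real n * ln (real n)))" (is "summable ?a") by simp
  then obtain M where M: "\<And>m n. m \<ge> M \<Longrightarrow> norm (sum ?a {m..<n}) < 1/2"
    using summable_Cauchy[of ?a] by (metis half_gt_zero_iff zero_less_one)
  define K where "K = (\<Sum>n\<in>{1..M}. mangoldt n / real n)"
  have K: "K \<ge> 0" unfolding K_def by (intro sum_nonneg) (auto simp: mangoldt_nonneg)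
  have "ln (real N) \<le> 2 * (K + 1)" if N: "N \<ge> 1" for N
  proof -
    have "ln (real N) - 1 \<le> (\<Sum>n\<in>{1..N}. mangoldt n / real n)" by (rule mertens_lower[OF N])
    also have "\<dots> \<le> (\<Sum>n\<in>{1..M} \<union> {Suc M..<Suc N}. mangoldt n / real n)"
      by (rule sum_mono2) (auto simp: mangoldt_nonneg)
    also have "\<dots> = K + (\<Sum>n\<in>{Suc M..<Suc N}. mangoldt n / real n)"
      unfolding K_def by (rule sum.union_disjoint) auto
    also have "(\<Sum>n\<in>{Suc M..<Suc N}. mangoldt n / real n) \<le> (\<Sum>n\<in>{Suc M..<Suc N}. ?a n * ln (real N))"
    proof (rule sum_mono)
      fix n assume n: "n \<in> {Suc M..<Suc N}"
      show "mangoldt n / real n \<le> ?a n * ln (real N)"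
      proof (cases "n = 1")
        case False
        with n have "n > 1" "n \<le> N" by auto
        then have ln: "0 < ln (real n)" "ln (real n) \<le> ln (real N)" by auto
        then have "mangoldt n / real n = ?a n * ln (real n)" by simp
        also have "\<dots> \<le> ?a n * ln (real N)" using ln by (intro mult_left_mono divide_nonneg_nonneg) (auto simp: mangoldt_nonneg)
        finally show ?thesis .
      qed simp
    qed
    also have "\<dots> = sum ?a {Suc M..<Suc N} * ln (real N)" by (simp only: sum_distrib_right)
    also have "\<dots> \<le> 1/2 * ln (real N)" using M[of "Suc M" "Suc N"] N by (intro mult_right_mono) auto
    finally show ?thesis by simp
  qed
  then show False using not_ln_bounded by blast
qed

context nonprincipal_character
begin

text \<open>
Dirichlet's test with the decreasing factor \<open>1 / ln n\<close>, followed by removing the higher prime powers.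
\<close>
lemma prime_sum_summable:
  assumes "L_value \<noteq> 0"
  shows "summable (\<lambda>n. if prime n then chi n / of_nat n else 0)"
proof -
  obtain C where C: "\<And>N. norm (\<Sum>n\<in>{1..N}. chi n * of_real (mangoldt n / real n)) \<le> C"
    using Lambda_sum_bounded[OF assms] unfolding Lambda_sum_def by blast
  define g where "g = (\<lambda>n. 1 / ln (real n))"
  have dec: "g (Suc n) \<le> g n" if "n \<ge> 2" for n
    using that unfolding g_def by (intro divide_left_mono mult_pos_pos) auto
  have "filterlim (\<lambda>n. ln (real n)) at_top sequentially"
    by (rule filterlim_compose[OF ln_at_top filterlim_real_sequentially])
  then have lim: "g \<longlonglongrightarrow> 0" unfolding g_def by (intro tendsto_divide_0[OF tendsto_const] filterlim_at_top_imp_at_infinity)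
  obtain l where "(\<lambda>N. \<Sum>n\<in>{1..N}. chi n * of_real (mangoldt n / real n) * of_real (g n)) \<longlonglongrightarrow> l"
    using dirichlet_test[OF C dec lim] by metis
  then have "(\<lambda>n. chi n * of_real (mangoldt n / real n) * of_real (g n)) sums l"
    by (rule sums_if_partial_sums_from_1) simp
  then have 1: "summable (\<lambda>n. chi n * of_real (mangoldt n / (real n * ln (real n))))"
    by (simp add: g_def summable_def) blast
  have 2: "summable (\<lambda>n. chi n * of_real (mangoldt n / (real n * ln (real n)) - (if prime n then 1 / real n else 0)))"
  proof (rule summable_comparison_test'[OF mangoldt_over_ln_diff_summable, of 0])
    fix n
    show "norm (chi n * of_real (mangoldt n / (real n * ln (real n)) - (if prime n then 1 / real n else 0)))
      \<le> mangoldt n / (real n * ln (real n)) - (if prime n then 1 / real n else 0)"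
      unfolding norm_mult norm_of_real abs_of_nonneg[OF mangoldt_over_ln_diff_nonneg]
      by (rule mult_left_le_one_le[OF mangoldt_over_ln_diff_nonneg norm_ge_zero norm_le])
  qed
  from summable_diff[OF 1 2] have "summable (\<lambda>n. chi n * of_real (if prime n then 1 / real n else 0))"
    by (simp add: algebra_simps)
  also have "(\<lambda>n. chi n * of_real (if prime n then 1 / real n else 0)) = (\<lambda>n. if prime n then chi n / of_nat n else 0)"
    by auto
  finally show ?thesis .
qed

end

section \<open>Discrete logarithms modulo powers of two\<close>

lemma chi4_mult:
  assumes "odd a" "odd b"
  shows "chi4 (a * b) = chi4 a * chi4 b"
proof -
  have ab: "a mod 4 = 1 \<or> a mod 4 = 3" "b mod 4 = 1 \<or> b mod 4 = 3" using assms by presburger+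
  have "(a * b) mod 4 = (a mod 4) * (b mod 4) mod 4" by (simp add: mod_mult_eq)
  then show ?thesis using ab by (elim disjE) (simp_all add: chi4_def)
qed

lemma chi4_odd: "odd a \<Longrightarrow> chi4 a = 1 \<or> chi4 a = - 1"
  unfolding chi4_def by presburger

lemma chi4_minus: "chi4 (- a) = - chi4 a"
proof -
  consider "a mod 4 = 0" | "a mod 4 = 1" | "a mod 4 = 2" | "a mod 4 = 3" by linarith
  moreover have "(- a) mod 4 = (- (a mod 4)) mod 4" by (simp add: mod_minus_eq)
  ultimately show ?thesis by cases (simp_all add: chi4_def)
qed

lemma chi4_cong:
  assumes "[a = b] (mod 2 ^ m)" "m \<ge> 2"
  shows "chi4 a = chi4 b"
proof -
  have "(4::int) dvd 2 ^ m" using le_imp_power_dvd[OF assms(2), of "2::int"] by simp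
  then have "a mod 4 = b mod 4" using assms(1) cong_dvd_modulus cong_def by metis
  then show ?thesis by (simp add: chi4_def)
qed

lemma chi4_5_power: "chi4 (5 ^ k) = 1"
  by (induction k) (simp_all add: chi4_mult, simp_all add: chi4_def)

lemma ord_5_twopow:
  assumes "m \<ge> 2"
  shows "ord (2 ^ m) (5 :: nat) = 2 ^ (m - 2)"
proof (cases "m = 2")
  case True
  have "ord (2 ^ 2) (5 :: nat) = 1" by (subst ord_eq_Suc_0_iff[folded One_nat_def]) (simp add: cong_def)
  then show ?thesis using True by simp
next
  case False
  then show ?thesis using assms by (intro ord_twopow_3_5) auto
qed

lemma cong_5_power_iff:
  assumes "m \<ge> 2"
  shows "[(5 :: int) ^ x = 5 ^ y] (mod 2 ^ m) \<longleftrightarrow> [x = y] (mod 2 ^ (m - 2))"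
proof -
  have "[(5 :: int) ^ x = 5 ^ y] (mod 2 ^ m) \<longleftrightarrow> [(5 :: nat) ^ x = 5 ^ y] (mod 2 ^ m)"
    using cong_int_iff[of "5 ^ x" "5 ^ y" "2 ^ m"] by simp
  also have "\<dots> \<longleftrightarrow> [x = y] (mod 2 ^ (m - 2))"
    using order_divides_expdiff[of "2 ^ m" 5 x y] ord_5_twopow[OF assms] by simp
  finally show ?thesis .
qed

text \<open>
Counting: the powers of 5 take \<open>2 ^ (m - 2)\<close> values modulo \<open>2 ^ m\<close>, the order of 5, and all of them are 1 modulo 4.
There are no more than \<open>2 ^ (m - 2)\<close> such residues.
\<close>
lemma exists_5_power_cong:
  fixes n :: int
  assumes "m \<ge> 2" "chi4 n = 1"
  shows "\<exists>k. [5 ^ k = n] (mod 2 ^ m)"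
proof -
  define R where "R = (\<lambda>j. 4 * j + 1 :: int) ` {0..<2 ^ (m - 2)}"
  \<comment> \<open>\<open>R\<close> is the set of residues that are 1 modulo 4, and \<open>X\<close> is the set of residues of powers of 5.\<close>
  define X where "X = (\<lambda>k. (5::int) ^ k mod 2 ^ m) ` {..<2 ^ (m - 2)}"
  have q: "(2::int) ^ m = 4 * 2 ^ (m - 2)"
  proof -
    obtain j where "m = 2 + j" using assms(1) le_Suc_ex by blast
    then show ?thesis by (simp add: power_add)
  qed
  have R: "R = {x. 0 \<le> x \<and> x < 2 ^ m \<and> x mod 4 = 1}"
  proof (intro subset_antisym subsetI)
    fix x assume "x \<in> {x. 0 \<le> x \<and> x < 2 ^ m \<and> x mod 4 = (1::int)}"
    then have x: "0 \<le> x" "x < 4 * 2 ^ (m - 2)" "x mod 4 = 1" using q by auto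
    have "x = 4 * (x div 4) + 1" using x(3) mult_div_mod_eq[of 4 x] by simp
    moreover have "x div 4 \<in> {0..<2 ^ (m - 2)}" using x by auto
    ultimately show "x \<in> R" unfolding R_def by blast
  qed (auto simp: R_def q)
  have "card R = 2 ^ (m - 2)" unfolding R_def by (subst card_image) (auto simp: inj_on_def nat_power_eq)
  moreover have "card X = 2 ^ (m - 2)" unfolding X_def
  proof (subst card_image)
    show "inj_on (\<lambda>k. (5::int) ^ k mod 2 ^ m) {..<2 ^ (m - 2)}"
    proof (rule inj_onI)
      fix x y assume *: "x \<in> {..<2 ^ (m - 2)}" "y \<in> {..<2 ^ (m - 2)}" "(5::int) ^ x mod 2 ^ m = 5 ^ y mod 2 ^ m"
      then have "[x = y] (mod 2 ^ (m - 2))" using cong_5_power_iff[OF assms(1)] unfolding cong_def by blast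
      then show "x = y" using * by (simp add: cong_def)
    qed
  qed simp
  moreover have "X \<subseteq> R"
  proof
    fix x assume "x \<in> X"
    then obtain k where k: "x = 5 ^ k mod 2 ^ m" by (auto simp: X_def)
    have "[x = 5 ^ k] (mod 2 ^ m)" by (simp add: k)
    then have "chi4 x = 1" using chi4_cong[OF _ assms(1)] chi4_5_power by metis
    then have "x mod 4 = 1" by (auto simp: chi4_def split: if_splits)
    then show "x \<in> R" by (simp add: R k)
  qed
  ultimately have "X = R" by (metis card_subset_eq finite_atLeastLessThan_int finite_imageI R_def)
  have "[n mod 2 ^ m = n] (mod 2 ^ m)" by simp
  then have "chi4 (n mod 2 ^ m) = 1" using chi4_cong[OF _ assms(1)] assms(2) by metis
  then have "n mod 2 ^ m mod 4 = 1" by (auto simp: chi4_def split: if_splits)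
  then have "n mod 2 ^ m \<in> X" unfolding \<open>X = R\<close> R by simp
  then show ?thesis by (auto simp: X_def cong_def)
qed

text \<open>
For \<open>m \<ge> 2\<close>, every odd residue modulo \<open>2 ^ m\<close> is uniquely \<open>5 ^ k\<close> or \<open>- (5 ^ k)\<close> with \<open>k < 2 ^ (m - 2)\<close>; the sign is \<open>chi4\<close>.
\<close>
definition log5 :: "nat \<Rightarrow> nat \<Rightarrow> nat" where
  "log5 m n = (LEAST k. [5 ^ k = int n] (mod 2 ^ m) \<or> [5 ^ k = - int n] (mod 2 ^ m))"

lemma log5_cong:
  assumes "m \<ge> 2" "odd n"
  shows "[5 ^ log5 m n = chi4 (int n) * int n] (mod 2 ^ m)"
proof -
  have sgn: "[5 ^ k = int n] (mod 2 ^ m) \<or> [5 ^ k = - int n] (mod 2 ^ m) \<longleftrightarrow> [5 ^ k = chi4 (int n) * int n] (mod 2 ^ m)" for k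
    using chi4_odd[of "int n"] assms chi4_cong[of "5 ^ k" "int n" m] chi4_cong[of "5 ^ k" "- int n" m]
    by (auto simp: chi4_5_power chi4_minus)
  have "chi4 (chi4 (int n) * int n) = 1"
    using chi4_odd[of "int n"] assms by (auto simp: chi4_minus)
  from exists_5_power_cong[OF assms(1) this] show ?thesis
    unfolding log5_def sgn by (rule LeastI_ex)
qed

lemma log5_cong_unique:
  assumes "m \<ge> 2" "odd n" "[5 ^ k = int n] (mod 2 ^ m) \<or> [5 ^ k = - int n] (mod 2 ^ m)"
  shows "[k = log5 m n] (mod 2 ^ (m - 2))"
proof -
  have "[5 ^ k = chi4 (int n) * int n] (mod 2 ^ m)"
    using chi4_odd[of "int n"] assms chi4_cong[of "5 ^ k" "int n" m] chi4_cong[of "5 ^ k" "- int n" m]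
    by (auto simp: chi4_5_power chi4_minus)
  then have "[5 ^ k = (5::int) ^ log5 m n] (mod 2 ^ m)"
    using log5_cong[OF assms(1,2)] cong_sym cong_trans by blast
  then show ?thesis using cong_5_power_iff[OF assms(1)] by simp
qed

lemma log5_less:
  assumes "m \<ge> 2" "odd n"
  shows "log5 m n < 2 ^ (m - 2)"
proof -
  let ?k = "log5 m n mod 2 ^ (m - 2)"
  have "[(5::int) ^ ?k = 5 ^ log5 m n] (mod 2 ^ m)"
    unfolding cong_5_power_iff[OF assms(1)] by simp
  then have "[5 ^ ?k = chi4 (int n) * int n] (mod 2 ^ m)" using log5_cong[OF assms] cong_trans by blast
  then have "[5 ^ ?k = int n] (mod 2 ^ m) \<or> [5 ^ ?k = - int n] (mod 2 ^ m)"
    using chi4_odd[of "int n"] assms by auto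
  then have "log5 m n \<le> ?k" unfolding log5_def by (rule Least_le)
  also have "\<dots> < 2 ^ (m - 2)" by simp
  finally show ?thesis .
qed

lemma log5_mod_eq:
  assumes "[a = b] (mod 2 ^ m)"
  shows "log5 m a = log5 m b"
proof -
  have "[int a = int b] (mod 2 ^ m)" using assms by (simp flip: cong_int_iff)
  then have "[5 ^ k = int a] (mod 2 ^ m) \<longleftrightarrow> [5 ^ k = int b] (mod 2 ^ m)"
    "[5 ^ k = - int a] (mod 2 ^ m) \<longleftrightarrow> [5 ^ k = - int b] (mod 2 ^ m)" for k
    using cong_trans cong_sym cong_minus_minus_iff by blast+
  then show ?thesis by (simp add: log5_def)
qed

lemma log5_mult:
  assumes "m \<ge> 2" "odd a" "odd b"
  shows "[log5 m (a * b) = log5 m a + log5 m b] (mod 2 ^ (m - 2))"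
proof -
  have "[5 ^ (log5 m a + log5 m b) = (chi4 (int a) * int a) * (chi4 (int b) * int b)] (mod 2 ^ m)"
    unfolding power_add by (intro cong_mult log5_cong assms)
  also have "(chi4 (int a) * int a) * (chi4 (int b) * int b) = chi4 (int (a * b)) * int (a * b)"
    using assms by (simp add: chi4_mult)
  finally have "[5 ^ (log5 m a + log5 m b) = int (a * b)] (mod 2 ^ m) \<or> [5 ^ (log5 m a + log5 m b) = - int (a * b)] (mod 2 ^ m)"
    using chi4_odd[of "int (a * b)"] assms by auto
  then have "[log5 m a + log5 m b = log5 m (a * b)] (mod 2 ^ (m - 2))"
    using log5_cong_unique[OF assms(1), of "a * b"] assms by simp
  then show ?thesis by (rule cong_sym)
qed

lemma residue_determined_by_chi4_log5:
  assumes "m \<ge> 2" "odd a" "odd b" "chi4 (int a) = chi4 (int b)" "log5 m a = log5 m b"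
  shows "[a = b] (mod 2 ^ m)"
proof -
  have "[chi4 (int a) * int a = chi4 (int a) * int b] (mod 2 ^ m)"
    using log5_cong[OF assms(1,2)] log5_cong[OF assms(1,3)] assms(4,5) cong_sym cong_trans by metis
  then have "[int a = int b] (mod 2 ^ m)" using chi4_odd[of "int a"] assms(2) by (auto simp: cong_minus_minus_iff)
  then show ?thesis using cong_int_iff[of a b "2 ^ m"] by simp
qed

section \<open>The characters modulo powers of two\<close>

lemma power_eq_if_cong:
  fixes z :: "'a :: monoid_mult"
  assumes "z ^ N = 1" "[x = y] (mod N)"
  shows "z ^ x = z ^ y"
proof -
  have "z ^ x = z ^ (x mod N)" for x
    using mult_div_mod_eq[of N x] assms(1) by (metis power_add power_mult power_one mult_1)
  then show ?thesis using assms(2) by (metis cong_def)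
qed

text \<open>
Multiplication by \<open>g\<close> permutes the residues modulo \<open>q\<close>, so the sum is invariant under multiplication by \<open>f g \<noteq> 1\<close>.
\<close>
lemma sum_multiplicative_eq_0:
  fixes f :: "nat \<Rightarrow> complex"
  assumes "q > 0" "\<And>a b. f (a * b) = f a * f b" "\<And>n. f (n + q) = f n" "coprime g q" "f g \<noteq> 1"
  shows "(\<Sum>n<q. f n) = 0"
proof -
  have per: "f (n mod q) = f n" for n
  proof -
    have "f (r + k * q) = f r" for r k
    proof (induction k)
      case (Suc k)
      have "f (r + Suc k * q) = f ((r + k * q) + q)" by (simp add: algebra_simps)
      then show ?case using Suc assms(3) by simp
    qed simp
    from this[of "n mod q" "n div q"] show ?thesis by simp
  qed
  have inj: "inj_on (\<lambda>n. g * n mod q) {..<q}"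
  proof (rule inj_onI)
    fix x y assume *: "x \<in> {..<q}" "y \<in> {..<q}" "g * x mod q = g * y mod q"
    then have "[g * x = g * y] (mod q)" by (simp add: cong_def)
    then have "[x = y] (mod q)" using assms(4) cong_mult_lcancel_nat by blast
    then show "x = y" using * by (simp add: cong_def)
  qed
  have "(\<lambda>n. g * n mod q) ` {..<q} = {..<q}"
    by (rule endo_inj_surj[OF _ _ inj]) (use assms(1) in auto)
  then have "(\<Sum>n<q. f n) = (\<Sum>n\<in>(\<lambda>n. g * n mod q) ` {..<q}. f n)" by simp
  also have "\<dots> = (\<Sum>n<q. f g * f n)"
    using inj by (subst sum.reindex) (auto simp: per assms(2))
  also have "\<dots> = f g * (\<Sum>n<q. f n)" by (simp add: sum_distrib_left)
  finally show ?thesis using assms(5) by simp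
qed

text \<open>
For \<open>m \<ge> 2\<close>, \<open>i \<le> 1\<close> and \<open>z\<close> a root of unity of order dividing \<open>2 ^ (m - 2)\<close>, these are the characters of the group of odd
residues modulo \<open>2 ^ m\<close>, which is the product of \<open>{1, -1}\<close> and the cyclic group generated by 5. The principal
character is \<open>i = 0\<close>, \<open>z = 1\<close>.
\<close>
definition twopow_char :: "nat \<Rightarrow> nat \<Rightarrow> complex \<Rightarrow> nat \<Rightarrow> complex" where
  "twopow_char m i z n = (if odd n then of_int (chi4 (int n)) ^ i * z ^ log5 m n else 0)"

lemma norm_eq_1_if_root_of_unity:
  fixes z :: complex
  assumes "z ^ N = 1" "N > 0"
  shows "norm z = 1"
proof -
  have "norm z ^ N = 1" using assms(1) by (metis norm_one norm_power)
  then show ?thesis using assms(2) power_eq_imp_eq_base[of "norm z" N 1] by simp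
qed

lemma twopow_char_mult:
  assumes "m \<ge> 2" "z ^ 2 ^ (m - 2) = 1"
  shows "twopow_char m i z (a * b) = twopow_char m i z a * twopow_char m i z b"
proof (cases "odd a \<and> odd b")
  case True
  then have "z ^ log5 m (a * b) = z ^ (log5 m a + log5 m b)"
    using power_eq_if_cong[OF assms(2) log5_mult[OF assms(1)]] by blast
  then show ?thesis using True by (simp add: twopow_char_def chi4_mult power_mult_distrib power_add)
qed (auto simp: twopow_char_def)

lemma log5_5:
  assumes "m \<ge> 2" "z ^ 2 ^ (m - 2) = (1 :: complex)"
  shows "z ^ log5 m 5 = z"
proof -
  have "[1 = log5 m 5] (mod 2 ^ (m - 2))" by (rule log5_cong_unique) (use assms in auto)
  from power_eq_if_cong[OF assms(2) this] show ?thesis by simp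
qed

text \<open>
The residue 3, or else 5, is a point at which the character differs from 1.
\<close>
lemma twopow_char_nonprincipal:
  assumes "m \<ge> 2" "z ^ 2 ^ (m - 2) = 1" "i = 1 \<or> z \<noteq> 1"
  shows "nonprincipal_character (twopow_char m i z) (2 ^ m)"
proof -
  have periodic: "twopow_char m i z (n + 2 ^ m) = twopow_char m i z n" for n
  proof -
    have *: "[n + 2 ^ m = n] (mod 2 ^ m)" by (simp add: cong_def)
    then have "[int (n + 2 ^ m) = int n] (mod 2 ^ m)" by (simp add: cong_def)
    then have "chi4 (int (n + 2 ^ m)) = chi4 (int n)" using chi4_cong assms(1) by blast
    moreover have "log5 m (n + 2 ^ m) = log5 m n" using log5_mod_eq[OF *] .
    ultimately show ?thesis using assms(1) by (simp add: twopow_char_def)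
  qed
  have "\<exists>g. odd g \<and> twopow_char m i z g \<noteq> 1"
  proof (cases "z = 1")
    case True
    then have "i = 1" using assms(3) by simp
    then have "twopow_char m i z 3 = -1" using True by (simp add: twopow_char_def chi4_def)
    then show ?thesis by (intro exI[of _ 3]) auto
  next
    case False
    then show ?thesis using log5_5[OF assms(1,2)]
      by (intro exI[of _ 5]) (auto simp: twopow_char_def chi4_def)
  qed
  then obtain g where g: "odd g" "twopow_char m i z g \<noteq> 1" by blast
  have "norm z = 1" using norm_eq_1_if_root_of_unity[OF assms(2)] by simp
  have "[0 = log5 m 1] (mod 2 ^ (m - 2))" by (rule log5_cong_unique) (use assms in auto)
  from power_eq_if_cong[OF assms(2) this] have z1: "z ^ log5 m 1 = 1" by simp
  show ?thesis
  proof
    show "twopow_char m i z 1 = 1" using z1 by (simp add: twopow_char_def chi4_def)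
    show "norm (twopow_char m i z n) \<le> 1" for n
      using chi4_odd[of "int n"] \<open>norm z = 1\<close> by (auto simp: twopow_char_def norm_mult norm_power)
    show "(\<Sum>n<2 ^ m. twopow_char m i z n) = 0"
      by (rule sum_multiplicative_eq_0[where g = g]) (use g twopow_char_mult[OF assms(1,2)] periodic in auto)
  qed (use twopow_char_mult[OF assms(1,2)] periodic in auto)
qed

lemma twopow_char_square:
  "twopow_char m i z n ^ 2 = twopow_char m 0 (z ^ 2) n"
proof (cases "odd n")
  case True
  have "(of_int (chi4 (int n)) ^ i :: complex) ^ 2 = (of_int (chi4 (int n)) ^ 2) ^ i"
    by (simp add: power_mult[symmetric] mult.commute)
  also have "\<dots> = 1" using chi4_odd[of "int n"] True by auto
  finally show ?thesis using True by (simp add: twopow_char_def power_mult_distrib power_mult[symmetric] mult.commute)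
qed (simp add: twopow_char_def)

text \<open>
The parity of \<open>log5 m n\<close> is visible modulo 8, because \<open>5 ^ k\<close> is 1 or 5 modulo 8 according to the parity of \<open>k\<close>.
So a character with \<open>z = 1\<close> or \<open>z = -1\<close> depends only on \<open>n mod 8\<close>.
\<close>
lemma twopow_char_real:
  assumes "m \<ge> 2" "z ^ 2 ^ (m - 2) = 1" "z = 1 \<or> z = -1"
  shows "twopow_char m i z n = (if odd n then of_int (chi4 (int n)) ^ i * (if n mod 8 \<in> {3, 5} then z else 1) else 0)"
proof (cases "z = 1")
  case True
  then show ?thesis by (simp add: twopow_char_def)
next
  case False
  then have z: "z = -1" using assms(3) by simp
  \<comment> \<open>For \<open>m = 2\<close> the root of unity \<open>z\<close> would have to be 1.\<close>
  have m: "m \<ge> 3"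
  proof (rule ccontr)
    assume "\<not> m \<ge> 3"
    then show False using assms(1,2) z by (simp add: eval_nat_numeral le_Suc_eq)
  qed
  have "z ^ log5 m n = (if n mod 8 \<in> {3, 5} then z else 1)" if n: "odd n"
  proof -
    have "(8::int) dvd 2 ^ m" using le_imp_power_dvd[OF m, of "2::int"] by simp
    then have c: "[5 ^ log5 m n = chi4 (int n) * int n] (mod 8)"
      using log5_cong[OF assms(1) n] cong_dvd_modulus by blast
    have p: "(5::int) ^ k mod 8 = (if even k then 1 else 5)" for k
    proof (induction k)
      case (Suc k)
      have "(5::int) ^ Suc k mod 8 = 5 * (5 ^ k mod 8) mod 8" by (simp add: mod_mult_right_eq)
      then show ?case using Suc by simp
    qed simp
    have int_mod: "int n mod 8 = int k" if "n mod 8 = k" for k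
      using zmod_int[of n 8] that by simp
    have "n mod 8 = 1 \<or> n mod 8 = 3 \<or> n mod 8 = 5 \<or> n mod 8 = 7" using n by presburger
    then consider "int n mod 8 = 1" "n mod 8 = 1" | "int n mod 8 = 3" "n mod 8 = 3"
      | "int n mod 8 = 5" "n mod 8 = 5" | "int n mod 8 = 7" "n mod 8 = 7"
      using int_mod[of 1] int_mod[of 3] int_mod[of 5] int_mod[of 7] by force
    then have "chi4 (int n) * int n mod 8 = (if n mod 8 \<in> {3, 5} then 5 else 1)"
    proof cases
      case 1
      have "int n mod 4 = 1" using 1(1) by presburger
      then show ?thesis unfolding chi4_def 1(2) using 1(1) by simp
    next
      case 2
      have "int n mod 4 = 3" using 2(1) by presburger
      moreover have "(- int n) mod 8 = 5" using 2(1) by presburger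
      ultimately show ?thesis unfolding chi4_def 2(2) by simp
    next
      case 3
      have "int n mod 4 = 1" using 3(1) by presburger
      then show ?thesis unfolding chi4_def 3(2) using 3(1) by simp
    next
      case 4
      have "int n mod 4 = 3" using 4(1) by presburger
      moreover have "(- int n) mod 8 = 1" using 4(1) by presburger
      ultimately show ?thesis unfolding chi4_def 4(2) by simp
    qed
    then have "odd (log5 m n) \<longleftrightarrow> n mod 8 \<in> {3, 5}"
      using c p[of "log5 m n"] unfolding cong_def by (auto split: if_splits)
    then show ?thesis by (auto simp: z)
  qed
  then show ?thesis by (simp add: twopow_char_def)
qed

section \<open>Nonvanishing for characters modulo powers of two\<close>

text \<open>
The sign patterns are those of the three nonprincipal characters modulo 8 at the residues 1, 3, 5, 7. Two of them follow
from monotonicity of \<open>1 / x\<close>, and \<open>(+, -, -, +)\<close> from its convexity.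
\<close>
lemma block_of_eight_nonneg:
  fixes x s t :: real
  assumes "x > 0" "(s, t) \<in> {(-1, 1), (1, -1), (-1, -1)}"
  shows "1 / x + s / (x + 2) + t / (x + 4) + s * t / (x + 6) \<ge> 0"
proof -
  have "1 / (x + 2) \<le> 1 / x" "1 / (x + 4) \<le> 1 / (x + 2)" "1 / (x + 6) \<le> 1 / (x + 4)"
    using assms(1) by (auto intro!: divide_left_mono)
  moreover have "1 / x - 1 / (x + 2) \<ge> 1 / (x + 4) - 1 / (x + 6)"
  proof -
    have "1 / x - 1 / (x + 2) = 2 / (x * (x + 2))" "1 / (x + 4) - 1 / (x + 6) = 2 / ((x + 4) * (x + 6))"
      using assms(1) by (simp_all add: field_simps)
    moreover have "2 / ((x + 4) * (x + 6)) \<le> 2 / (x * (x + 2))"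
      using assms(1) by (intro divide_left_mono mult_mono mult_pos_pos) auto
    ultimately show ?thesis by simp
  qed
  ultimately show ?thesis using assms(2) by auto
qed

text \<open>
If \<open>z\<^sup>2 \<noteq> 1\<close>, the square of the character is nonprincipal. Otherwise the character is one of the three real ones
modulo 8. Then the first block of eight terms of \<open>L(1, \<chi>)\<close> is at least \<open>1 - 1 / 3 - 1 / 5 + 1 / 7 \<ge> 1 / 2\<close>, and the
later blocks are nonnegative.
\<close>
lemma twopow_char_L_value_nonzero:
  assumes "m \<ge> 2" "z ^ 2 ^ (m - 2) = 1" "i = 1 \<or> z \<noteq> 1" "i \<le> 1"
  shows "nonprincipal_character.L_value (twopow_char m i z) \<noteq> 0"
proof (cases "z ^ 2 = 1")
  case False
  have "nonprincipal_character (twopow_char m 0 (z ^ 2)) (2 ^ m)"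
  proof (rule twopow_char_nonprincipal[OF assms(1)])
    show "(z ^ 2) ^ 2 ^ (m - 2) = 1" using assms(2) by (metis power_mult mult.commute power_one)
  qed (use False in simp)
  then have "nonprincipal_character (\<lambda>n. twopow_char m i z n ^ 2) (2 ^ m)" by (simp only: twopow_char_square)
  then show ?thesis using L_value_nonzero_if_square_nonprincipal twopow_char_nonprincipal[OF assms(1-3)] by blast
next
  case True
  then have z: "z = 1 \<or> z = -1" by (simp add: power2_eq_1_iff)
  interpret X: nonprincipal_character "twopow_char m i z" "2 ^ m" by (rule twopow_char_nonprincipal) fact+
  \<comment> \<open>The values at the residues 3 and 5 modulo 8; the value at 7 is their product.\<close>
  define s t :: real where "s = (-1) ^ i * Re z" and "t = Re z"
  have st: "(s, t) \<in> {(-1, 1), (1, -1), (-1, -1)}"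
    using z assms(3,4) by (cases i) (auto simp: s_def t_def)
  have stz: "s * t = (-1) ^ i" using z by (auto simp: s_def t_def)
  have val: "Re (twopow_char m i z n) = (if n mod 8 = 1 then 1 else if n mod 8 = 3 then s else if n mod 8 = 5 then t else if n mod 8 = 7 then s * t else 0)" for n
  proof -
    have "int n mod 4 = int (n mod 8) mod 4" by (simp add: zmod_int mod_mod_cancel)
    moreover have "odd n \<longleftrightarrow> n mod 8 \<in> {1, 3, 5, 7}" by (simp; presburger)
    ultimately show ?thesis
      unfolding twopow_char_real[OF assms(1,2) z] stz using z by (auto simp: chi4_def s_def t_def)
  qed
  have T_Suc: "Re (X.L_partial (Suc n)) = Re (X.L_partial n) + Re (twopow_char m i z (Suc n)) / real (Suc n)" for n
    by (simp add: X.L_partial_def)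
  have T8: "Re (X.L_partial (8 * k + 8)) = Re (X.L_partial (8 * k)) +
     (1 / (8 * real k + 1) + s / (8 * real k + 1 + 2) + t / (8 * real k + 1 + 4) + s * t / (8 * real k + 1 + 6))" for k
  proof -
    have "8 * k + 8 = Suc (Suc (Suc (Suc (Suc (Suc (Suc (Suc (8 * k))))))))" by simp
    moreover have "Suc (8 * k) mod 8 = 1" "Suc (Suc (8 * k)) mod 8 = 2" "Suc (Suc (Suc (8 * k))) mod 8 = 3"
      "Suc (Suc (Suc (Suc (8 * k)))) mod 8 = 4" "Suc (Suc (Suc (Suc (Suc (8 * k))))) mod 8 = 5"
      "Suc (Suc (Suc (Suc (Suc (Suc (8 * k)))))) mod 8 = 6"
      "Suc (Suc (Suc (Suc (Suc (Suc (Suc (8 * k))))))) mod 8 = 7"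
      "Suc (Suc (Suc (Suc (Suc (Suc (Suc (Suc (8 * k)))))))) mod 8 = 0"
      by presburger+
    ultimately show ?thesis by (simp only: T_Suc val) (simp add: add_ac)
  qed
  have "Re (X.L_partial (8 * k + 8)) \<ge> 1 / 2" for k
  proof (induction k)
    case 0
    have "Re (X.L_partial 0) = 0" by (simp add: X.L_partial_def)
    then show ?case using T8[of 0] st by auto
  next
    case (Suc k)
    have "0 < 8 * real (Suc k) + 1" by simp
    from block_of_eight_nonneg[OF this st]
    have "Re (X.L_partial (8 * Suc k + 8)) \<ge> Re (X.L_partial (8 * Suc k))" unfolding T8 by linarith
    moreover have "8 * k + 8 = 8 * Suc k" by simp
    ultimately show ?case using Suc by (metis order_trans)
  qed
  moreover have "(\<lambda>k. Re (X.L_partial (8 * k + 8))) \<longlonglongrightarrow> Re X.L_value"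
    by (intro tendsto_Re LIMSEQ_subseq_LIMSEQ[OF X.L_partial_tendsto, unfolded comp_def]) (auto simp: strict_mono_def)
  ultimately have "Re X.L_value \<ge> 1 / 2" by (intro tendsto_lowerbound[of _ _ sequentially]) auto
  then show ?thesis by auto
qed

section \<open>Prime sums over residue classes modulo powers of two\<close>

definition root_unity :: "nat \<Rightarrow> nat \<Rightarrow> complex" where
  "root_unity N j = cis (2 * pi * real j / real N)"

lemma root_unity_power: "N > 0 \<Longrightarrow> root_unity N j ^ N = 1"
  unfolding root_unity_def Complex.DeMoivre by simp

text \<open>
The summand is \<open>c ^ i * r ^ j\<close>, where \<open>c\<close> compares the signs of \<open>a\<close> and \<open>n\<close>, and \<open>r\<close> compares their logarithms; so the
double sum is a product of two geometric sums.
\<close>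
lemma twopow_char_orthogonality:
  assumes "m \<ge> 2" "odd a" "odd n"
  shows "(\<Sum>i<2. \<Sum>j<2 ^ (m - 2). cnj (twopow_char m i (root_unity (2 ^ (m - 2)) j) a) * twopow_char m i (root_unity (2 ^ (m - 2)) j) n)
    = (if [n = a] (mod 2 ^ m) then 2 ^ (m - 1) else 0)"
proof -
  define N :: nat where "N = 2 ^ (m - 2)"
  \<comment> \<open>\<open>root_unity N j ^ k\<close> is symmetric in \<open>j\<close> and \<open>k\<close>, so the dependence on \<open>j\<close> can be written as a \<open>j\<close>-th power.\<close>
  define r where "r = cnj (root_unity N (log5 m a)) * root_unity N (log5 m n)"
  define c :: complex where "c = of_int (chi4 (int a) * chi4 (int n))"
  have N: "N > 0" by (simp add: N_def)
  have swap: "root_unity N j ^ k = root_unity N k ^ j" for j k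
    unfolding root_unity_def Complex.DeMoivre by (simp add: mult_ac)
  have summand: "cnj (twopow_char m i (root_unity N j) a) * twopow_char m i (root_unity N j) n = c ^ i * r ^ j" for i j
    using assms by (simp add: twopow_char_def c_def r_def power_mult_distrib swap[of j] mult_ac)
  have rN: "r ^ N = 1" by (simp add: r_def power_mult_distrib root_unity_power N flip: complex_cnj_power)
  have "(\<Sum>i<2. \<Sum>j<N. cnj (twopow_char m i (root_unity N j) a) * twopow_char m i (root_unity N j) n) = (\<Sum>i<2. c ^ i) * (\<Sum>j<N. r ^ j)"
    by (simp add: summand sum_product)
  also have "(\<Sum>i<2. c ^ i) = (if chi4 (int a) = chi4 (int n) then 2 else 0)"
    using chi4_odd[of "int a"] chi4_odd[of "int n"] assms by (auto simp: c_def eval_nat_numeral)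
  also have "(\<Sum>j<N. r ^ j) = (if log5 m a = log5 m n then of_nat N else 0)"
  proof (cases "log5 m a = log5 m n")
    case True
    have "r = 1" by (simp add: r_def True root_unity_def cis_mult cis_cnj)
    then show ?thesis using True by simp
  next
    case False
    have "r \<noteq> 1"
    proof
      assume "r = 1"
      then have "root_unity N (log5 m a) * (cnj (root_unity N (log5 m a)) * root_unity N (log5 m n)) = root_unity N (log5 m a)"
        by (simp add: r_def)
      then have "root_unity N (log5 m n) = root_unity N (log5 m a)"
        by (simp add: root_unity_def cis_mult cis_cnj mult.assoc[symmetric])
      then show False using False log5_less[OF assms(1,2)] log5_less[OF assms(1,3)] Complex.bij_betw_roots_unity[OF N]
        unfolding bij_betw_def inj_on_def root_unity_def N_def by auto
    qed
    then show ?thesis using False rN by (simp add: geometric_sum)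
  qed
  also have "(if chi4 (int a) = chi4 (int n) then 2 else 0) * (if log5 m a = log5 m n then of_nat N else 0)
     = (if [n = a] (mod 2 ^ m) then 2 ^ (m - 1) else (0 :: complex))"
  proof (cases "[n = a] (mod 2 ^ m)")
    case True
    have "[int n = int a] (mod 2 ^ m)" using True by (simp flip: cong_int_iff)
    moreover have "2 * (2 :: complex) ^ (m - 2) = 2 ^ (m - 1)"
    proof -
      have "m - 1 = Suc (m - 2)" using assms(1) by simp
      then show ?thesis by simp
    qed
    ultimately show ?thesis using True chi4_cong[OF _ assms(1)] log5_mod_eq[OF True] by (auto simp: N_def)
  next
    case False
    then show ?thesis using residue_determined_by_chi4_log5[OF assms(1,3,2)] by auto
  qed
  finally show ?thesis by (simp add: N_def)
qed

text \<open>
Expand \<open>g\<close> in characters by orthogonality. All nonprincipal terms give convergent series, so the series converges iff the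
coefficient of the principal character vanishes, because \<open>\<Sum> 1 / p\<close> diverges.
\<close>
theorem prime_sum_over_residues_summable_iff:
  fixes g :: "nat \<Rightarrow> complex"
  assumes "m \<ge> 2"
  shows "summable (\<lambda>p. if prime p \<and> odd p then g (p mod 2 ^ m) / of_nat p else 0)
    \<longleftrightarrow> (\<Sum>a | a < 2 ^ m \<and> odd a. g a) = 0"
proof -
  define N :: nat where "N = 2 ^ (m - 2)"
  define R :: "nat set" where "R = {a. a < 2 ^ m \<and> odd a}"
  define d where "d = (\<lambda>(i, j). twopow_char m i (root_unity N j))"
  define I where "I = {..<2::nat} \<times> {..<N}"
  define c where "c ij = (\<Sum>a\<in>R. g a * cnj (d ij a)) / 2 ^ (m - 1)" for ij
  define u where "u ij p = (if prime p then d ij p / of_nat p else 0)" for ij p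
  have N: "N > 0" by (simp add: N_def)
  have finR: "finite R" by (simp add: R_def)
  have expand: "(if prime p \<and> odd p then g (p mod 2 ^ m) / of_nat p else 0) = (\<Sum>ij\<in>I. c ij * u ij p)" (is "?t p = _") for p
  proof (cases "prime p \<and> odd p")
    case True
    have pR: "p mod 2 ^ m \<in> R" using True assms by (simp add: R_def dvd_mod_iff)
    have "(\<Sum>ij\<in>I. c ij * d ij p) = (\<Sum>ij\<in>I. \<Sum>a\<in>R. g a / 2 ^ (m - 1) * (cnj (d ij a) * d ij p))"
      unfolding c_def sum_distrib_right sum_divide_distrib by (intro sum.cong refl) simp
    also have "\<dots> = (\<Sum>a\<in>R. g a / 2 ^ (m - 1) * (\<Sum>ij\<in>I. cnj (d ij a) * d ij p))"
      by (subst sum.swap) (simp add: sum_distrib_left)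
    also have "\<dots> = (\<Sum>a\<in>R. if a = p mod 2 ^ m then g a else 0)"
    proof (intro sum.cong refl)
      fix a assume a: "a \<in> R"
      have "(\<Sum>ij\<in>I. cnj (d ij a) * d ij p) = (if [p = a] (mod 2 ^ m) then 2 ^ (m - 1) else 0)"
        using twopow_char_orthogonality[OF assms, of a p] a True
        unfolding I_def d_def R_def N_def sum.cartesian_product by (simp add: case_prod_unfold)
      also have "[p = a] (mod 2 ^ m) \<longleftrightarrow> a = p mod 2 ^ m" using a by (auto simp: R_def cong_def)
      finally show "g a / 2 ^ (m - 1) * (\<Sum>ij\<in>I. cnj (d ij a) * d ij p) = (if a = p mod 2 ^ m then g a else 0)"
        by simp
    qed
    also have "\<dots> = g (p mod 2 ^ m)" using pR finR by (simp add: sum.delta)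
    finally show ?thesis using True by (simp add: u_def sum_divide_distrib[symmetric])
  next
    case False
    then have "u ij p = 0" for ij by (cases ij) (auto simp: u_def d_def twopow_char_def)
    then show ?thesis using False by auto
  qed
  have summ: "summable (u ij)" if "ij \<in> I - {(0, 0)}" for ij
  proof -
    obtain i j where "ij = (i, j)" by (cases ij)
    with that have ij: "ij = (i, j)" "i < 2" "j < N" "(i, j) \<noteq> (0, 0)" by (auto simp: I_def)
    have "root_unity N j \<noteq> 1" if "j \<noteq> 0"
    proof
      assume "root_unity N j = 1"
      then have "root_unity N j = root_unity N 0" by (simp add: root_unity_def)
      then show False using that ij(3) N Complex.bij_betw_roots_unity[OF N]
        unfolding bij_betw_def inj_on_def root_unity_def by auto
    qed
    then have ne: "i = 1 \<or> root_unity N j \<noteq> 1" using ij by auto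
    have root: "root_unity N j ^ 2 ^ (m - 2) = 1" using root_unity_power[OF N] by (simp add: N_def)
    interpret X: nonprincipal_character "twopow_char m i (root_unity N j)" "2 ^ m"
      by (rule twopow_char_nonprincipal[OF assms root ne])
    have "X.L_value \<noteq> 0" using twopow_char_L_value_nonzero[OF assms root ne] ij(2) by simp
    from X.prime_sum_summable[OF this] show ?thesis unfolding u_def d_def ij(1) prod.case .
  qed
  have rest: "summable (\<lambda>p. \<Sum>ij\<in>I - {(0, 0)}. c ij * u ij p)"
    by (intro summable_sum summable_mult summ)
  have I0: "I = insert (0, 0) (I - {(0, 0)})" "finite (I - {(0,0)})" using N by (auto simp: I_def)
  have "(\<lambda>p. \<Sum>ij\<in>I. c ij * u ij p) = (\<lambda>p. c (0, 0) * u (0, 0) p + (\<Sum>ij\<in>I - {(0, 0)}. c ij * u ij p))"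
    by (subst I0(1), subst sum.insert) (use I0(2) in auto)
  then have split: "?t = (\<lambda>p. c (0, 0) * u (0, 0) p + (\<Sum>ij\<in>I - {(0, 0)}. c ij * u ij p))"
    by (simp only: expand)
  have "summable ?t \<longleftrightarrow> summable (\<lambda>p. c (0, 0) * u (0, 0) p)"
  proof
    assume "summable ?t"
    from summable_diff[OF this[unfolded split] rest]
    show "summable (\<lambda>p. c (0, 0) * u (0, 0) p)" by (simp only: add_diff_cancel_right')
  next
    assume "summable (\<lambda>p. c (0, 0) * u (0, 0) p)"
    then show "summable ?t" unfolding split using rest by (rule summable_add)
  qed
  also have "\<dots> \<longleftrightarrow> c (0, 0) = 0"
  proof -
    have "\<not> summable (u (0, 0))"
    proof
      assume "summable (u (0, 0))"
      then have sm: "summable (\<lambda>p. Re (u (0, 0) p))" by (rule summable_Re)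
      have "eventually (\<lambda>p. Re (u (0, 0) p) = (if prime p then 1 / real p else 0)) sequentially"
        using eventually_gt_at_top[of 2]
      proof eventually_elim
        case (elim p)
        have "u (0, 0) p = complex_of_real (if prime p \<and> odd p then 1 / real p else 0)"
          by (simp add: u_def d_def twopow_char_def root_unity_def)
        then have "Re (u (0, 0) p) = (if prime p \<and> odd p then 1 / real p else 0)" by (simp only: Re_complex_of_real)
        then show ?case using prime_odd_nat[of p] elim by presburger
      qed
      from summable_cong[OF this] sm show False using prime_harmonic_not_summable by simp
    qed
    then show ?thesis by (simp add: summable_cmult_iff)
  qed
  also have "c (0, 0) = (\<Sum>a\<in>R. g a) / 2 ^ (m - 1)"
    unfolding c_def by (intro arg_cong2[of _ _ _ _ "(/)"] sum.cong refl) (auto simp: d_def twopow_char_def root_unity_def R_def)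
  finally show ?thesis by (simp add: R_def)
qed

section \<open>The product over primes\<close>

lemma A_pos:
  assumes "prime p" "odd p"
  shows "A p > 0"
proof -
  have "p > 2" using assms prime_gt_1_nat[of p] by (cases "p = 2") auto
  then show ?thesis using chi4_odd[of "int p"] assms(2) by (auto simp: A_def)
qed

lemma ln_A_approx:
  assumes "prime p" "odd p"
  shows "\<bar>ln (A p) + 2 * (of_int (chi4 (int p)) / real p)\<bar> \<le> 4 * (1 / real p ^ 2)"
proof -
  define u :: real where "u = of_int (chi4 (int p)) / real p"
  have p: "p > 2" using assms prime_gt_1_nat[of p] by (cases "p = 2") auto
  have abs_u: "\<bar>u\<bar> = 1 / real p" using chi4_odd[of "int p"] assms(2) by (auto simp: u_def)
  have u: "\<bar>u\<bar> \<le> 1 / 2" unfolding abs_u using p by (intro divide_left_mono) auto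
  have "u ^ 2 = 1 / real p ^ 2" using abs_u by (metis power2_abs power_divide power_one)
  have "real p - of_int (chi4 (int p)) = real p * (1 - u)" "real p + of_int (chi4 (int p)) = real p * (1 + u)"
    using p by (simp_all add: u_def field_simps)
  then have "A p = (1 - u) / (1 + u)" using p by (simp add: A_def)
  also have "ln \<dots> = ln (1 + (- u)) - ln (1 + u)" using u by (subst ln_div) auto
  finally have "ln (A p) + 2 * u = (ln (1 + (- u)) - (- u)) - (ln (1 + u) - u)" by simp
  also have "\<bar>\<dots>\<bar> \<le> 2 * (- u)\<^sup>2 + 2 * u\<^sup>2"
    using abs_ln_one_plus_x_minus_x_bound[of "- u"] abs_ln_one_plus_x_minus_x_bound[of u] u by simp
  also have "\<dots> = 4 * (1 / real p ^ 2)" using \<open>u ^ 2 = _\<close> by simp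
  finally show ?thesis by (simp add: u_def)
qed

definition log_term :: "int \<Rightarrow> int set \<Rightarrow> nat \<Rightarrow> real" where
  "log_term q S p = (if prime p \<and> odd p \<and> int p mod q \<in> S then ln (A p) else 0)"

lemma P_eq_exp_sum: "P q S x = exp (\<Sum>p\<le>nat \<lfloor>x\<rfloor>. log_term q S p)"
proof -
  define Z where "Z = {p. prime p \<and> odd p \<and> real p \<le> x \<and> int p mod q \<in> S}"
  have le: "real p \<le> x \<longleftrightarrow> p \<le> nat \<lfloor>x\<rfloor>" if "prime p" for p
    using prime_gt_0_nat[OF that] by linarith
  have "P q S x = (\<Prod>p\<in>Z. exp (ln (A p)))"
    unfolding P_def Z_def by (intro prod.cong refl) (auto simp: A_pos)
  also have "\<dots> = exp (\<Sum>p\<in>Z. ln (A p))"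
    unfolding Z_def by (rule exp_sum[OF finite_P_index, symmetric])
  also have "(\<Sum>p\<in>Z. ln (A p)) = (\<Sum>p\<le>nat \<lfloor>x\<rfloor>. log_term q S p)"
    by (rule sum.mono_neutral_cong_left) (auto simp: Z_def log_term_def le)
  finally show ?thesis .
qed

lemma P_converges_iff:
  "(\<exists>L::real. 0 < L \<and> (P q S \<longlongrightarrow> L) at_top) \<longleftrightarrow> summable (log_term q S)"
proof
  assume "\<exists>L::real. 0 < L \<and> (P q S \<longlongrightarrow> L) at_top"
  then obtain L where L: "0 < L" "(P q S \<longlongrightarrow> L) at_top" by blast
  have "(\<lambda>n. P q S (real n)) \<longlonglongrightarrow> L"
    using filterlim_compose[OF L(2) filterlim_real_sequentially] .
  then have "(\<lambda>n. ln (P q S (real n))) \<longlonglongrightarrow> ln L" using L(1) by (intro tendsto_ln) auto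
  then have "(\<lambda>n. \<Sum>p\<le>n. log_term q S p) \<longlonglongrightarrow> ln L" by (simp add: P_eq_exp_sum)
  then show "summable (log_term q S)" by (auto simp: summable_def sums_def_le)
next
  assume "summable (log_term q S)"
  then obtain s where "(\<lambda>n. \<Sum>p\<le>n. log_term q S p) \<longlonglongrightarrow> s" by (auto simp: summable_def sums_def_le)
  then have lim: "(\<lambda>n. exp (\<Sum>p\<le>n. log_term q S p)) \<longlonglongrightarrow> exp s" by (rule tendsto_exp)
  have "filterlim (\<lambda>x::real. nat \<lfloor>x\<rfloor>) sequentially at_top"
    by (rule filterlim_compose[OF filterlim_nat_sequentially filterlim_floor_sequentially])
  from filterlim_compose[OF lim this] have "(P q S \<longlongrightarrow> exp s) at_top"
    by (simp add: P_eq_exp_sum[abs_def])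
  then show "\<exists>L::real. 0 < L \<and> (P q S \<longlongrightarrow> L) at_top" by (intro exI[of _ "exp s"]) auto
qed

lemma log_term_summable_iff:
  "summable (log_term q S) \<longleftrightarrow>
   summable (\<lambda>p. if prime p \<and> odd p \<and> int p mod q \<in> S then of_int (chi4 (int p)) / real p else 0)"
   (is "_ \<longleftrightarrow> summable ?v")
proof -
  have sq: "summable (\<lambda>p. 4 * (1 / real p ^ 2))"
    using inverse_power_summable[of 2, where ?'a = real] by (intro summable_mult) (simp add: field_simps)
  have e: "summable (\<lambda>p. log_term q S p + 2 * ?v p)"
    by (rule summable_comparison_test'[OF sq, of 0]) (use ln_A_approx in \<open>auto simp: log_term_def\<close>)
  have "summable ?v \<longleftrightarrow> summable (\<lambda>p. 2 * ?v p)" using summable_cmult_iff[of 2 ?v] by simp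
  moreover have "summable (\<lambda>p. 2 * ?v p)" if "summable (log_term q S)"
    using summable_diff[OF e that] by simp
  moreover have "summable (log_term q S)" if "summable (\<lambda>p. 2 * ?v p)"
    using summable_diff[OF e that] by simp
  ultimately show ?thesis by blast
qed

lemma Units_residue_ring_twopow_subset:
  assumes "m \<ge> 2" "q = 2 ^ m"
  shows "Units (residue_ring q) \<subseteq> {x. 0 \<le> x \<and> x < q \<and> odd x}"
proof -
  have "q > 1" using assms one_less_power[of "2::int" m] by simp
  then interpret residues q "residue_ring q" by unfold_locales auto
  show ?thesis using assms unfolding res_units_eq by auto
qed

lemma sum_chi4_over_residues:
  assumes "S \<subseteq> {x. 0 \<le> x \<and> x < 2 ^ m \<and> odd x}"
  shows "(\<Sum>a | a < 2 ^ m \<and> odd a. if int a \<in> S then of_int (chi4 (int a)) else 0) = (of_int (mu S) :: complex)"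
proof -
  have fin: "finite {a::nat. a < 2 ^ m \<and> odd a}" by simp
  have "(\<Sum>a | a < 2 ^ m \<and> odd a. if int a \<in> S then of_int (chi4 (int a)) else 0)
      = (\<Sum>a | (a < 2 ^ m \<and> odd a) \<and> int a \<in> S. of_int (chi4 (int a)) :: complex)"
    by (rule sum.mono_neutral_cong_right) (use fin in auto)
  also have "\<dots> = (\<Sum>a\<in>S. of_int (chi4 a))"
  proof (rule sum.reindex_bij_witness[where i = nat and j = int])
    fix b assume b: "b \<in> S"
    then have "0 \<le> b" "b < 2 ^ m" "odd b" using assms by auto
    then show "int (nat b) = b" "nat b \<in> {a. (a < 2 ^ m \<and> odd a) \<and> int a \<in> S}"
      using b by (auto simp: nat_less_iff even_nat_iff)
  qed auto
  finally show ?thesis by (simp add: mu_def)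
qed

theorem corollary1:
  fixes m :: nat and q :: int and S :: "int set"
  assumes "m \<ge> 2" and "q = 2 ^ m"
    and "S \<subseteq> Units (residue_ring q)"
  shows "(\<exists>L::real. 0 < L \<and> (P q S \<longlongrightarrow> L) at_top) \<longleftrightarrow> mu S = 0"
proof -
  define g where "g a = (if int a \<in> S then of_int (chi4 (int a)) else 0 :: complex)" for a
  have "4 dvd q" using le_imp_power_dvd[OF assms(1), of "2::int"] assms(2) by simp
  have g_mod: "g (p mod 2 ^ m) = (if int p mod q \<in> S then of_int (chi4 (int p)) else 0)" for p
  proof -
    have "int (p mod 2 ^ m) = int p mod q" using assms(2) by (simp add: zmod_int)
    then show ?thesis using chi4_mod[OF \<open>4 dvd q\<close>, of "int p"] by (simp add: g_def)
  qed
  have "(\<exists>L::real. 0 < L \<and> (P q S \<longlongrightarrow> L) at_top) \<longleftrightarrow>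
    summable (\<lambda>p. if prime p \<and> odd p \<and> int p mod q \<in> S then of_int (chi4 (int p)) / real p else 0)"
    unfolding P_converges_iff log_term_summable_iff ..
  also have "\<dots> \<longleftrightarrow> summable (\<lambda>p. complex_of_real (if prime p \<and> odd p \<and> int p mod q \<in> S then of_int (chi4 (int p)) / real p else 0))"
    by (rule summable_complex_of_real[symmetric])
  also have "(\<lambda>p. complex_of_real (if prime p \<and> odd p \<and> int p mod q \<in> S then of_int (chi4 (int p)) / real p else 0))
    = (\<lambda>p. if prime p \<and> odd p then g (p mod 2 ^ m) / of_nat p else 0)"
    by (auto simp: g_mod)
  also have "summable \<dots> \<longleftrightarrow> (\<Sum>a | a < 2 ^ m \<and> odd a. g a) = 0"
    by (rule prime_sum_over_residues_summable_iff[OF assms(1)])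
  also have "(\<Sum>a | a < 2 ^ m \<and> odd a. g a) = of_int (mu S)"
    unfolding g_def using sum_chi4_over_residues Units_residue_ring_twopow_subset[OF assms(1,2)] assms(2,3) by blast
  finally show ?thesis by simp
qed

end
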